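(* Let $S=K[t_1,\ldots,t_s]$ be a polynomial ring over a field $K$, let $\mathcal{L}\subset\mathbb{Z}^s$ be a lattice that is homogeneous with respect to an integral vector $\omega=(\omega_1,\ldots,\omega_s)$ with positive entries, and let $L=I(\mathcal{L})\subset S$ be its lattice ideal. Suppose that $V(L,t_i)=\{0\}$ for all $i=1,\ldots,s$. Then $L$ is a complete intersection if and only if there are homogeneous binomials $h_1,\ldots,h_{s-1}$ in $L$ satisfying the following conditions: (i) $\mathcal{L}=\langle\widehat{h}_1,\ldots,\widehat{h}_{s-1}\rangle$; (ii) $V(h_1,\ldots,h_{s-1},t_i)=\{0\}$ for all $i=1,\ldots,s$; (iii) for each $i=1,\ldots,s-1$ there is $a_i\in\mathbb{Z}^s$ such that $h_i=t^{a_i^+}-t^{a_i^-}$.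
   Context: $\mathbb{N}$ denotes the nonnegative integers; for $a=(a_1,\ldots,a_s)\in\mathbb{N}^s$, $t^a=t_1^{a_1}\cdots t_s^{a_s}$. A binomial is a polynomial of the form $g=t^a-t^b$ with $a,b\in\mathbb{N}^s$, and $\widehat{g}=a-b\in\mathbb{Z}^s$. Any $c\in\mathbb{Z}^s$ is written uniquely as $c=c^+-c^-$ with $c^+,c^-\in\mathbb{N}^s$ having disjoint supports. A lattice is a subgroup $\mathcal{L}$ of $\mathbb{Z}^s$; its lattice ideal is $I(\mathcal{L})=(\{t^{a^+}-t^{a^-}\mid a\in\mathcal{L}\})\subset S$. The lattice $\mathcal{L}$ is homogeneous with respect to $\omega$ if $\langle\omega,a\rangle=0$ (usual inner product) for all $a\in\mathcal{L}$. "Homogeneous" for polynomials refers to the grading of $S$ given by $\deg(t_i)=\omega_i$. For a subset $B\subset\mathbb{Z}^s$, $\langle B\rangle$ is the subgroup of $\mathbb{Z}^s$ generated by $B$. For a set or ideal $I\subset S$, $V(I)$ is the set of $a\in K^s$ with $f(a)=0$ for all $f\in I$; $V(L,t_i)$ is the zero set of the ideal $(L,t_i)$. An ideal $I\subset S$ is a complete intersection if there are $g_1,\ldots,g_r\in S$ with $I=(g_1,\ldots,g_r)$, where $r$ is the height of $I$. *)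

theory Defs
  imports
    "HOL-Algebra.Algebra"
    "HOL-Algebra.Algebraic_Closure_Type"
    "HOL-Analysis.Finite_Cartesian_Product"
    "HOL-Library.Extended_Nat"
    "HOL-Library.Poly_Mapping"
begin

section \<open>Height and complete intersections\<close>

definition prime_height :: "('a, 'm) ring_scheme \<Rightarrow> 'a set \<Rightarrow> enat" where
  "prime_height R P = Sup {enat n | n. \<exists>Q :: nat \<Rightarrow> 'a set.
     (\<forall>i\<le>n. primeideal (Q i) R) \<and> (\<forall>i<n. Q i \<subset> Q (Suc i)) \<and> Q n = P}"

text \<open>The unit ideal gets height \<open>\<infinity>\<close> (infimum of the empty set).\<close>

definition ideal_height :: "('a, 'm) ring_scheme \<Rightarrow> 'a set \<Rightarrow> enat" where
  "ideal_height R I = Inf {prime_height R P | P. primeideal P R \<and> I \<subseteq> P}"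

definition complete_intersection :: "('a, 'm) ring_scheme \<Rightarrow> 'a set \<Rightarrow> bool" where
  "complete_intersection R I \<longleftrightarrow> ideal I R \<and>
     (\<exists>(r :: nat) (g :: nat \<Rightarrow> 'a). g ` {..<r} \<subseteq> carrier R \<and>
        I = Idl\<^bsub>R\<^esub> (g ` {..<r}) \<and> enat r = ideal_height R I)"

section \<open>The polynomial ring\<close>

text \<open>
  The variables \<open>t\<^sub>1, \<dots>, t\<^sub>s\<close> are indexed by a finite type \<open>'s\<close> with \<open>s = CARD('s)\<close>.
  A polynomial over \<open>'k\<close> is a finitely supported map from exponent vectors in \<open>\<nat>\<^sup>s\<close> to
  coefficients; its multiplication is convolution with respect to addition of exponents.
\<close>

type_synonym ('k, 's) mpoly = "(nat, 's) vec \<Rightarrow>\<^sub>0 'k"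

abbreviation mpoly_ring :: "('k::field, 's::finite) mpoly ring" where
  "mpoly_ring \<equiv> ring_of_type_algebra"

definition monomial :: "nat ^ 's \<Rightarrow> ('k::field, 's::finite) mpoly" where
  "monomial a = Poly_Mapping.single a 1"

definition indet :: "'s \<Rightarrow> ('k::field, 's::finite) mpoly" where
  "indet i = monomial (axis i 1)"

definition eval_mpoly :: "('k::field, 's::finite) mpoly \<Rightarrow> 'k ^ 's \<Rightarrow> 'k" where
  "eval_mpoly f x =
     (\<Sum>a\<in>Poly_Mapping.keys f. Poly_Mapping.lookup f a * (\<Prod>i\<in>UNIV. x $ i ^ (a $ i)))"

definition zero_set :: "('k::field, 's::finite) mpoly set \<Rightarrow> ('k ^ 's) set" where
  "zero_set F = {x. \<forall>f\<in>F. eval_mpoly f x = 0}"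

definition homogeneous :: "int ^ 's \<Rightarrow> ('k::field, 's::finite) mpoly \<Rightarrow> bool" where
  "homogeneous \<omega> f \<longleftrightarrow>
     (\<exists>d. \<forall>a\<in>Poly_Mapping.keys f. (\<Sum>i\<in>UNIV. \<omega> $ i * int (a $ i)) = d)"

section \<open>Binomials, lattices and lattice ideals\<close>

definition int_vec :: "nat ^ 's::finite \<Rightarrow> int ^ 's" where
  "int_vec a = (\<chi> i. int (a $ i))"

definition pos_part :: "int ^ 's::finite \<Rightarrow> nat ^ 's" where
  "pos_part c = (\<chi> i. nat (c $ i))"

definition neg_part :: "int ^ 's::finite \<Rightarrow> nat ^ 's" where
  "neg_part c = (\<chi> i. nat (- (c $ i)))"

lemma pos_neg_decomposition:
  "c = int_vec a - int_vec b \<and> (\<forall>i. a $ i = 0 \<or> b $ i = 0) \<longleftrightarrow>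
   a = pos_part c \<and> b = neg_part c"
proof
  assume *: "c = int_vec a - int_vec b \<and> (\<forall>i. a $ i = 0 \<or> b $ i = 0)"
  have "a $ i = nat (c $ i) \<and> b $ i = nat (- (c $ i))" for i
  proof -
    have "c $ i = int (a $ i) - int (b $ i)" and "a $ i = 0 \<or> b $ i = 0"
      using * by (auto simp: int_vec_def)
    then show ?thesis by auto
  qed
  then show "a = pos_part c \<and> b = neg_part c"
    by (simp add: pos_part_def neg_part_def vec_eq_iff)
qed (auto simp: pos_part_def neg_part_def int_vec_def vec_eq_iff)

definition is_binomial :: "('k::field, 's::finite) mpoly \<Rightarrow> bool" where
  "is_binomial g \<longleftrightarrow> (\<exists>a b. g = monomial a - monomial b)"

text \<open>
  \<open>binomial_hat (t\<^sup>a - t\<^sup>b) = a - b\<close>. In characteristic \<open>2\<close> the polynomial only determines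
  \<open>a - b\<close> up to sign, so one of the two values is chosen; the subgroup generated by such vectors
  does not depend on that choice.
\<close>

definition binomial_hat :: "('k::field, 's::finite) mpoly \<Rightarrow> int ^ 's" where
  "binomial_hat g = (SOME c. \<exists>a b. g = monomial a - monomial b \<and> c = int_vec a - int_vec b)"

lemma binomial_hat_eq:
  fixes a b :: "nat ^ 's::finite"
  defines "g \<equiv> (monomial a - monomial b :: ('k::field, 's) mpoly)"
  shows "binomial_hat g = int_vec a - int_vec b \<or>
         (CHAR('k) = 2 \<and> binomial_hat g = int_vec b - int_vec a)"
proof -
  have "\<exists>c. \<exists>a b. g = monomial a - monomial b \<and> c = int_vec a - int_vec b"
    unfolding g_def by blast
  from someI_ex[OF this] obtain a' b' where
    g': "g = monomial a' - monomial b'" and hat: "binomial_hat g = int_vec a' - int_vec b'"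
    unfolding binomial_hat_def by blast
  have eq: "(if x = a then 1 else 0) - (if x = b then 1 else 0) =
      (if x = a' then 1 else 0) - (if x = b' then 1 else (0::'k))" for x
    using arg_cong[OF g'[unfolded g_def], of "\<lambda>p. Poly_Mapping.lookup p x"]
    by (simp add: monomial_def lookup_minus lookup_single when_def eq_commute)
  show ?thesis
  proof (cases "a = b")
    case True
    then have "a' = b'" using eq[of a'] by (auto split: if_splits)
    then show ?thesis using True hat by simp
  next
    case False
    then have "(a' = a \<and> b' = b) \<or> ((1::'k) = - 1 \<and> a' = b \<and> b' = a)"
      using eq[of a] eq[of b] eq[of a'] eq[of b'] by (auto split: if_splits)
    moreover have "CHAR('k) = 2" if "(1::'k) = - 1"
    proof (rule CHAR_eqI)
      show "of_nat 2 = (0::'k)" using that by (simp add: eq_neg_iff_add_eq_0)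
      show "2 dvd n" if "of_nat n = (0::'k)" for n
      proof (rule ccontr)
        assume "\<not> 2 dvd n"
        then obtain m where "n = 2 * m + 1" by (rule oddE)
        with that \<open>of_nat 2 = (0::'k)\<close> show False by simp
      qed
    qed
    ultimately show ?thesis using hat by auto
  qed
qed

definition int_vec_group :: "(int ^ 's::finite) monoid" where
  "int_vec_group = \<lparr>carrier = UNIV, monoid.mult = (+), one = 0\<rparr>"

definition homogeneous_lattice :: "int ^ 's \<Rightarrow> (int ^ 's::finite) set \<Rightarrow> bool" where
  "homogeneous_lattice \<omega> \<L> \<longleftrightarrow> (\<forall>a\<in>\<L>. (\<Sum>i\<in>UNIV. \<omega> $ i * a $ i) = 0)"

definition lattice_ideal :: "(int ^ 's::finite) set \<Rightarrow> ('k::field, 's) mpoly set" where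
  "lattice_ideal \<L> = Idl\<^bsub>mpoly_ring\<^esub> {monomial (pos_part a) - monomial (neg_part a) | a. a \<in> \<L>}"

end

theory Submission
  imports Defs
begin

text \<open>
  \<open>\<Leftarrow>\<close>: Only the supports of the two monomials of each \<open>h\<^sub>j\<close> matter in condition (ii). It forces every
  nonempty set \<open>R\<close> of variables to admit fewer than \<open>|R|\<close> of the \<open>h\<^sub>j\<close> whose monomials both involve \<open>R\<close>.
  Taking for \<open>R\<close> the complement of a variable shows that each variable has a power among the monomials of
  some \<open>h\<^sub>j\<close>; as there is one binomial less than variables, some \<open>h\<^sub>j\<close> only involves two variables, one
  on each side. Merging these two and iterating
  exhibits the \<open>h\<^sub>j\<close> as an iterated gluing, and gluing preserves cancellativity of the congruence on
  \<open>\<nat>\<^sup>s\<close> generated by the \<open>h\<^sub>j\<close>. A cancellative congruence identifies \<open>a\<^sup>+\<close> and \<open>a\<^sup>-\<close> for all \<open>a\<close> in the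
  lattice, so that \<open>L = (h\<^sub>1, \<dots>, h\<^sub>s\<^sub>-\<^sub>1)\<close>. The gluing also yields \<open>t\<^sub>k\<^sup>m - t\<^sub>i\<^sup>n \<in> L\<close>, whence below every prime
  \<open>P \<supseteq> L\<close> there is a chain of length \<open>s - 1\<close>: contract \<open>P\<close> to fewer and fewer variables and extend back.

  \<open>\<Rightarrow>\<close>: The vanishing ideal of a monomial curve is a prime over \<open>L\<close> strictly below the maximal ideal of the
  origin. Chains of primes have length at most \<open>s\<close>, because any \<open>s + 1\<close> polynomials are algebraically
  dependent; so \<open>L\<close> has height at most \<open>s - 1\<close>. By the graded Nakayama lemma, no more binomials than a
  given number of generators are needed to generate \<open>L\<close>, and such binomials satisfy (i) and (ii).
\<close>

no_notation fps_nth (infixl "$" 75)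

section \<open>Ideals of the ring on a type\<close>

lemma ideal_type_iff:
  "ideal I (ring_of_type_algebra :: 'a::comm_ring_1 ring) \<longleftrightarrow>
     0 \<in> I \<and> (\<forall>x\<in>I. \<forall>y\<in>I. x + y \<in> I) \<and> (\<forall>x\<in>I. \<forall>r. r * x \<in> I)"
  (is "ideal I ?R \<longleftrightarrow> ?rhs")
proof
  assume "ideal I ?R"
  then interpret ideal I ?R .
  show ?rhs
    using additive_subgroup.zero_closed[OF additive_subgroup_axioms]
      additive_subgroup.a_closed[OF additive_subgroup_axioms] I_l_closed
    by (simp add: ring_of_type_algebra_def)
next
  assume r: ?rhs
  interpret ring ?R by (rule ring_from_type_algebra)
  show "ideal I ?R"
  proof (rule idealI)
    show "ring ?R" by (rule ring_from_type_algebra)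
    show "subgroup I (add_monoid ?R)"
    proof (rule add.subgroupI)
      show "I \<subseteq> carrier ?R" by (simp add: ring_of_type_algebra_def)
      show "I \<noteq> {}" using r by auto
      show "a \<in> I \<Longrightarrow> b \<in> I \<Longrightarrow> a \<oplus>\<^bsub>?R\<^esub> b \<in> I" for a b
        using r by (simp add: ring_of_type_algebra_def)
      fix a assume a: "a \<in> I"
      have "\<ominus>\<^bsub>?R\<^esub> a = - a"
        by (rule minus_equality) (simp_all add: ring_of_type_algebra_def)
      then show "\<ominus>\<^bsub>?R\<^esub> a \<in> I"
        using a r by (metis mult_minus1)
    qed
  qed (use r in \<open>auto simp: ring_of_type_algebra_def mult.commute\<close>)
qed

lemma primeideal_type_iff:
  "primeideal P (ring_of_type_algebra :: 'a::comm_ring_1 ring) \<longleftrightarrow>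
     ideal P (ring_of_type_algebra :: 'a ring) \<and> 1 \<notin> P \<and>
     (\<forall>x y. x * y \<in> P \<longrightarrow> x \<in> P \<or> y \<in> P)"
  (is "primeideal P ?R \<longleftrightarrow> ?rhs")
proof
  assume "primeideal P ?R"
  then interpret primeideal P ?R .
  have "P \<noteq> UNIV" using I_notcarr by (auto simp: ring_of_type_algebra_def)
  then have "1 \<notin> P"
    using is_ideal unfolding ideal_type_iff by (metis UNIV_eq_I mult.right_neutral)
  then show ?rhs
    using is_ideal I_prime by (simp add: ring_of_type_algebra_def)
next
  assume r: ?rhs
  show "primeideal P ?R"
    by (rule primeidealI) (use r in \<open>auto simp: ring_of_type_algebra_def cring_from_type_algebra[unfolded ring_of_type_algebra_def]\<close>)
qed

lemma ideal_Idl: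
  "ideal (Idl\<^bsub>ring_of_type_algebra\<^esub> F) (ring_of_type_algebra :: 'a::comm_ring_1 ring)"
proof -
  interpret ring "ring_of_type_algebra :: 'a ring" by (rule ring_from_type_algebra)
  show ?thesis by (rule genideal_ideal) (simp add: ring_of_type_algebra_def)
qed

lemma Idl_superset: "F \<subseteq> Idl\<^bsub>(ring_of_type_algebra :: 'a::comm_ring_1 ring)\<^esub> F"
proof -
  interpret ring "ring_of_type_algebra :: 'a ring" by (rule ring_from_type_algebra)
  show ?thesis by (rule genideal_self) (simp add: ring_of_type_algebra_def)
qed

lemma Idl_subsetI:
  assumes "ideal I (ring_of_type_algebra :: 'a::comm_ring_1 ring)" and "F \<subseteq> I"
  shows "Idl\<^bsub>(ring_of_type_algebra :: 'a ring)\<^esub> F \<subseteq> I"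
proof -
  interpret ring "ring_of_type_algebra :: 'a ring" by (rule ring_from_type_algebra)
  show ?thesis by (rule genideal_minimal) fact+
qed

lemma ideal_mult:
  fixes x :: "'a::comm_ring_1"
  assumes "ideal I ring_of_type_algebra" and "x \<in> I"
  shows "r * x \<in> I" and "x * r \<in> I"
  using assms unfolding ideal_type_iff by (auto simp: mult.commute)

lemma ideal_add:
  fixes x :: "'a::comm_ring_1"
  assumes "ideal I ring_of_type_algebra" and "x \<in> I" "y \<in> I"
  shows "x + y \<in> I"
  using assms unfolding ideal_type_iff by simp

lemma ideal_uminus:
  fixes x :: "'a::comm_ring_1"
  assumes "ideal I ring_of_type_algebra" and "x \<in> I"
  shows "- x \<in> I"
  using assms unfolding ideal_type_iff by (metis mult_minus1)

lemma ideal_diff: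
  fixes x :: "'a::comm_ring_1"
  assumes "ideal I ring_of_type_algebra" and "x \<in> I" "y \<in> I"
  shows "x - y \<in> I"
  using assms ideal_uminus[OF assms(1,3)] unfolding ideal_type_iff
  by (metis diff_conv_add_uminus)

lemma ideal_sum:
  fixes f :: "'b \<Rightarrow> 'a::comm_ring_1"
  assumes I: "ideal I ring_of_type_algebra" and f: "\<And>x. x \<in> A \<Longrightarrow> f x \<in> I"
  shows "sum f A \<in> I"
  using I f unfolding ideal_type_iff
  by (induction A rule: infinite_finite_induct) auto

lemma primeideal_power:
  fixes x :: "'a::comm_ring_1"
  assumes "primeideal P ring_of_type_algebra" and "x ^ n \<in> P"
  shows "x \<in> P"
  using assms(2) by (induction n) (use assms(1) in \<open>auto simp: primeideal_type_iff\<close>)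

section \<open>Evaluation of polynomials\<close>

lemma mpoly_sum_single:
  "(\<Sum>a\<in>Poly_Mapping.keys f. Poly_Mapping.single a (Poly_Mapping.lookup f a)) = f"
  by (rule poly_mapping_eqI) (simp add: lookup_sum lookup_single when_def in_keys_iff)

lemma mpoly_induct [case_names zero add single]:
  assumes "P 0" and "\<And>f g. P f \<Longrightarrow> P g \<Longrightarrow> P (f + g)"
    and "\<And>a c. P (Poly_Mapping.single a c)"
  shows "P (f :: 'a \<Rightarrow>\<^sub>0 'b::comm_monoid_add)"
proof -
  have "P (\<Sum>a\<in>A. Poly_Mapping.single a (Poly_Mapping.lookup f a))" for A
    by (induction A rule: infinite_finite_induct) (auto intro: assms)
  then show ?thesis by (metis mpoly_sum_single)
qed

definition const :: "'k \<Rightarrow> ('k::field, 's::finite) mpoly" where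
  "const c = Poly_Mapping.single 0 c"

lemma single_eq_const_mult: "Poly_Mapping.single a c = const c * monomial a"
  by (simp add: const_def monomial_def mult_single)

lemma monomial_add: "monomial (a + b) = monomial a * monomial b"
  by (simp add: monomial_def mult_single)

lemma monomial_0: "monomial 0 = 1"
  by (simp add: monomial_def)

lemma lookup_const_mult: "Poly_Mapping.lookup (const c * f) a = c * Poly_Mapping.lookup f a"
  by (simp add: const_def mult_map_scale_conv_mult[symmetric] Poly_Mapping.map.rep_eq when_def)

lemma const_add: "const (c + d) = const c + const d"
  by (simp add: const_def single_add)

lemma const_mult: "const (c * d) = const c * const d"
  by (simp add: const_def mult_single)

lemma const_0: "const 0 = 0"
  by (simp add: const_def)

lemma const_1: "const 1 = 1"
  by (simp add: const_def)

lemmas const_simps = const_add const_mult const_0 const_1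

text \<open>Linear algebra over the coefficient field serves to count power products, to exchange
  generators for binomials and to treat ideals as spans.\<close>

interpretation mpoly: vector_space
  "\<lambda>(c::'k::field) (f::('k, 's::finite) mpoly). const c * f"
  by unfold_locales (simp_all add: const_simps algebra_simps)

text \<open>The universal property of the polynomial ring: a homomorphism on the coefficients and
  arbitrary images of the variables extend to the homomorphism \<open>subst\<close>. Instances are
  evaluation at a point, expansion in powers of one variable and the parametrization of a monomial
  curve; primes arise as preimages under them.\<close>

locale mpoly_hom =
  fixes \<phi> :: "'k::field \<Rightarrow> 'a::comm_ring_1" and x :: "'s::finite \<Rightarrow> 'a"
  assumes \<phi>_0: "\<phi> 0 = 0" and \<phi>_1: "\<phi> 1 = 1"
    and \<phi>_add: "\<phi> (c + d) = \<phi> c + \<phi> d" and \<phi>_mult: "\<phi> (c * d) = \<phi> c * \<phi> d"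
begin

definition subst :: "('k, 's) mpoly \<Rightarrow> 'a" where
  "subst f = (\<Sum>a\<in>Poly_Mapping.keys f. \<phi> (Poly_Mapping.lookup f a) * (\<Prod>i\<in>UNIV. x i ^ (a $ i)))"

lemma subst_superset:
  assumes "finite A" "Poly_Mapping.keys f \<subseteq> A"
  shows "subst f = (\<Sum>a\<in>A. \<phi> (Poly_Mapping.lookup f a) * (\<Prod>i\<in>UNIV. x i ^ (a $ i)))"
  unfolding subst_def by (rule sum.mono_neutral_left) (use assms in \<open>auto simp: in_keys_iff \<phi>_0\<close>)

lemma subst_0: "subst 0 = 0"
  by (simp add: subst_def)

lemma subst_single: "subst (Poly_Mapping.single a c) = \<phi> c * (\<Prod>i\<in>UNIV. x i ^ (a $ i))"
  by (subst subst_superset[of "{a}"]) auto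

lemma subst_monomial: "subst (monomial a) = (\<Prod>i\<in>UNIV. x i ^ (a $ i))"
  by (simp add: monomial_def subst_single \<phi>_1)

lemma subst_1: "subst 1 = 1"
  using subst_monomial[of 0] by (simp add: monomial_0)

lemma subst_const: "subst (const c) = \<phi> c"
  by (simp add: const_def subst_single)

lemma subst_indet: "subst (indet i) = x i"
proof -
  have "(\<Prod>j\<in>UNIV. x j ^ (axis i (1::nat) $ j)) = (\<Prod>j\<in>UNIV. if j = i then x j else 1)"
    by (rule prod.cong) (auto simp: axis_def)
  then show ?thesis by (simp add: indet_def subst_monomial)
qed

lemma subst_add: "subst (f + g) = subst f + subst g"
proof -
  let ?A = "Poly_Mapping.keys f \<union> Poly_Mapping.keys g"
  have "Poly_Mapping.keys (f + g) \<subseteq> ?A" by (rule Poly_Mapping.keys_add)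
  then show ?thesis
    by (simp add: subst_superset[of ?A] lookup_add \<phi>_add distrib_right sum.distrib)
qed

lemma subst_mult: "subst (f * g) = subst f * subst g"
proof (induction f rule: mpoly_induct)
  case (single a c)
  show ?case
  proof (induction g rule: mpoly_induct)
    case (single b d)
    show ?case
      by (simp add: mult_single subst_single \<phi>_mult power_add prod.distrib mult_ac)
  qed (simp_all add: subst_0 subst_add distrib_left)
qed (simp_all add: subst_0 subst_add distrib_right)

lemma subst_diff: "subst (f - g) = subst f - subst g"
  using subst_add[of "f - g" g] by simp

lemma ideal_vimage:
  assumes "ideal I ring_of_type_algebra"
  shows "ideal (subst -` I) ring_of_type_algebra"
  using assms by (simp add: ideal_type_iff subst_0 subst_add subst_mult)

lemma primeideal_vimage:
  assumes "primeideal P ring_of_type_algebra"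
  shows "primeideal (subst -` P) ring_of_type_algebra"
proof -
  have "ideal (subst -` P) ring_of_type_algebra"
    using assms ideal_vimage by (simp add: primeideal_type_iff)
  then show ?thesis using assms by (simp add: primeideal_type_iff subst_1 subst_mult)
qed

end

lemma monomial_axis: "monomial (axis i n) = (indet i :: ('k::field, 's::finite) mpoly) ^ n"
proof (induction n)
  case (Suc n)
  have "(axis i (Suc n) :: nat ^ 's) = axis i 1 + axis i n"
    by (simp add: vec_eq_iff axis_def)
  then show ?case by (simp add: monomial_add Suc indet_def)
qed (simp add: monomial_0[symmetric] axis_def zero_vec_def)

lemma mpoly_hom_const: "mpoly_hom (const :: 'k::field \<Rightarrow> ('k, 's::finite) mpoly)"
  by unfold_locales (simp_all add: const_simps)

lemma mpoly_subst_id: "mpoly_hom.subst const indet f = (f :: ('k::field, 's::finite) mpoly)"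
proof -
  interpret mpoly_hom const "indet :: 's \<Rightarrow> ('k, 's) mpoly"
    by (rule mpoly_hom_const)
  have mon: "subst (monomial a) = monomial a" for a :: "nat ^ 's"
  proof -
    have "(\<Prod>i\<in>A. indet i ^ (a $ i)) = (monomial (\<Sum>i\<in>A. axis i (a $ i)) :: ('k, 's) mpoly)" for A
      by (induction A rule: infinite_finite_induct) (simp_all add: monomial_0 monomial_add monomial_axis)
    moreover have "(\<Sum>i\<in>UNIV. axis i (a $ i)) = a"
      by (simp add: vec_eq_iff axis_def)
    ultimately show ?thesis by (simp add: subst_monomial)
  qed
  show ?thesis
    by (induction f rule: mpoly_induct)
       (simp_all add: subst_0 subst_add single_eq_const_mult subst_mult subst_const mon)
qed

lemma mpoly_hom_id: "mpoly_hom (\<lambda>c :: 'k::field. c)"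
  by unfold_locales auto

lemma eval_mpoly_eq_subst: "eval_mpoly f x = mpoly_hom.subst (\<lambda>c. c) (\<lambda>i. x $ i) f"
  by (simp add: mpoly_hom.subst_def[OF mpoly_hom_id] eval_mpoly_def)

lemmas eval_mpoly_diff = mpoly_hom.subst_diff[OF mpoly_hom_id, where x = "\<lambda>i. x $ i", folded eval_mpoly_eq_subst]
  and eval_mpoly_monomial = mpoly_hom.subst_monomial[OF mpoly_hom_id, where x = "\<lambda>i. x $ i", folded eval_mpoly_eq_subst]
  and eval_mpoly_indet = mpoly_hom.subst_indet[OF mpoly_hom_id, where x = "\<lambda>i. x $ i", folded eval_mpoly_eq_subst]
  for x :: "'k::field ^ 's::finite"

lemma zero_set_Idl: "zero_set (Idl\<^bsub>mpoly_ring\<^esub> F) = zero_set F"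
proof
  show "zero_set (Idl\<^bsub>mpoly_ring\<^esub> F) \<subseteq> zero_set F"
    using Idl_superset[of F] by (auto simp: zero_set_def)
  show "zero_set F \<subseteq> zero_set (Idl\<^bsub>mpoly_ring\<^esub> F)"
  proof
    fix x assume x: "x \<in> zero_set F"
    have "ideal ((\<lambda>f. eval_mpoly f x) -` {0}) mpoly_ring"
      unfolding eval_mpoly_eq_subst
      by (rule mpoly_hom.ideal_vimage[OF mpoly_hom_id]) (simp add: ideal_type_iff)
    then have "Idl\<^bsub>mpoly_ring\<^esub> F \<subseteq> (\<lambda>f. eval_mpoly f x) -` {0}"
      by (rule Idl_subsetI) (use x in \<open>auto simp: zero_set_def\<close>)
    then show "x \<in> zero_set (Idl\<^bsub>mpoly_ring\<^esub> F)" by (auto simp: zero_set_def)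
  qed
qed

section \<open>Gluing\<close>

text \<open>\<open>P j\<close> and \<open>N j\<close> stand for the supports of the two monomials of
  a binomial; the condition on \<open>T\<close> says that the binomial vanishes at the 0/1 indicator
  point of \<open>T\<close>. If a column violates it on \<open>A\<close>, exactly one of its sides
  lies in \<open>A\<close>; deleting an element of that side leaves neither side inside, which
  settles the column for all smaller sets. Each deletion spends one column, and there are fewer
  columns than elements.\<close>

lemma column_closed_subset:
  fixes P N :: "'j \<Rightarrow> 'v set"
  assumes "finite A" "finite C" "card C < card A"
    and "\<And>j. j \<in> C \<Longrightarrow> P j = {} \<longleftrightarrow> N j = {}"
  shows "\<exists>T\<subseteq>A. T \<noteq> {} \<and> (\<forall>j\<in>C. P j \<subseteq> T \<longleftrightarrow> N j \<subseteq> T)"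
  using assms
proof (induction "card A" arbitrary: A C rule: less_induct)
  case less
  show ?case
  proof (cases "\<forall>j\<in>C. P j \<subseteq> A \<longleftrightarrow> N j \<subseteq> A")
    case True
    then show ?thesis using less.prems(3) by (intro exI[of _ A]) auto
  next
    case False
    then obtain j where j: "j \<in> C" "\<not> (P j \<subseteq> A \<longleftrightarrow> N j \<subseteq> A)" by blast
    \<comment> \<open>The side contained in \<open>A\<close> is nonempty because the other one is;
      any element of it serves as \<open>x\<close>.\<close>
    then obtain x where x: "x \<in> A" "\<not> P j \<subseteq> A - {x}" "\<not> N j \<subseteq> A - {x}"
      using less.prems(4)[OF j(1)] by blast
    have "card (A - {x}) < card A" using x(1) less.prems(1) by (rule card_Diff1_less[rotated])
    moreover have "card C > 0" using j(1) less.prems(2) by (auto simp: card_gt_0_iff)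
    then have "card (C - {j}) < card (A - {x})"
      using x(1) j(1) less.prems(1-3) by (simp add: card_Diff_singleton_if)
    ultimately obtain T where "T \<subseteq> A - {x}" "T \<noteq> {}" "\<forall>j\<in>C - {j}. P j \<subseteq> T \<longleftrightarrow> N j \<subseteq> T"
      using less.hyps[of "A - {x}" "C - {j}"] less.prems by auto
    with x show ?thesis by (intro exI[of _ T]) blast
  qed
qed

definition mixed :: "('j \<Rightarrow> 'v set) \<Rightarrow> ('j \<Rightarrow> 'v set) \<Rightarrow> 'v set \<Rightarrow> 'j \<Rightarrow> bool" where
  "mixed P N R j \<longleftrightarrow> P j \<inter> R \<noteq> {} \<and> N j \<inter> R \<noteq> {}"

text \<open>Otherwise the columns not mixed on \<open>R\<close> would be fewer than the elements
  outside \<open>R\<close>, and some nonempty \<open>T\<close> disjoint from \<open>R\<close> would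
  satisfy all of them. Mixed columns have neither side inside such a \<open>T\<close>, so no column
  would separate \<open>T\<close>.\<close>

lemma card_mixed_less:
  fixes P N :: "'j \<Rightarrow> 'v::finite set"
  assumes C: "finite C" "card C = CARD('v) - 1"
    and empty: "\<And>j. j \<in> C \<Longrightarrow> P j = {} \<longleftrightarrow> N j = {}"
    and separated: "\<And>T. T \<noteq> {} \<Longrightarrow> T \<noteq> UNIV \<Longrightarrow> \<exists>j\<in>C. (P j \<subseteq> T) \<noteq> (N j \<subseteq> T)"
    and R: "R \<noteq> {}"
  shows "card {j\<in>C. mixed P N R j} < card R"
proof (rule ccontr)
  assume *: "\<not> ?thesis"
  let ?M = "{j\<in>C. mixed P N R j}"
  have "card (C - ?M) = card C - card ?M" by (rule card_Diff_subset) (use C in auto)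
  moreover have "card (- R) = CARD('v) - card R" by (simp add: Compl_eq_Diff_UNIV card_Diff_subset)
  moreover have "card R \<le> CARD('v)" by (rule card_mono) auto
  moreover have "card R > 0" using R by (simp add: card_gt_0_iff)
  moreover have "card ?M \<le> card C" by (rule card_mono) (use C in auto)
  ultimately have "card (C - ?M) < card (- R)" using * C(2) by linarith
  then obtain T where T: "T \<subseteq> - R" "T \<noteq> {}" "\<forall>j\<in>C - ?M. P j \<subseteq> T \<longleftrightarrow> N j \<subseteq> T"
    using column_closed_subset[of "- R" "C - ?M" P N] C(1) empty by auto
  have "T \<noteq> UNIV" using T(1) R by auto
  then obtain j where "j \<in> C" "(P j \<subseteq> T) \<noteq> (N j \<subseteq> T)" using separated[OF T(2)] by metis
  moreover have "\<not> P j \<subseteq> T \<and> \<not> N j \<subseteq> T" if "mixed P N R j" using that T(1) by (auto simp: mixed_def)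
  ultimately show False using T(3) by blast
qed

text \<open>An empty column separates no set. Without it there are fewer columns than elements other
  than \<open>v\<close>, so some nonempty \<open>T\<close> missing \<open>v\<close> would not be
  separated.\<close>

lemma column_nonempty:
  fixes P N :: "'j \<Rightarrow> 'v::finite set"
  assumes C: "finite C" "card C = CARD('v) - 1"
    and empty: "\<And>j. j \<in> C \<Longrightarrow> P j = {} \<longleftrightarrow> N j = {}"
    and separated: "\<And>T. T \<noteq> {} \<Longrightarrow> T \<noteq> UNIV \<Longrightarrow> \<exists>j\<in>C. (P j \<subseteq> T) \<noteq> (N j \<subseteq> T)"
    and j: "j \<in> C"
  shows "P j \<noteq> {} \<and> N j \<noteq> {}"
proof (rule ccontr)
  assume "\<not> ?thesis"
  then have e: "P j = {}" "N j = {}" using empty[OF j] by auto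
  obtain v :: 'v where True by simp
  have cC: "card C > 0" using j C(1) by (auto simp: card_gt_0_iff)
  have "card (C - {j}) < card (UNIV - {v})"
    using j C cC by (simp add: card_Diff_singleton_if)
  then obtain T where T: "T \<subseteq> UNIV - {v}" "T \<noteq> {}" "\<forall>j\<in>C - {j}. P j \<subseteq> T \<longleftrightarrow> N j \<subseteq> T"
    using column_closed_subset[of "UNIV - {v}" "C - {j}" P N] C(1) empty by auto
  moreover have "T \<noteq> UNIV" using T(1) by auto
  ultimately obtain i where "i \<in> C" "(P i \<subseteq> T) \<noteq> (N i \<subseteq> T)" using separated[of T] by metis
  then show False using T(3) e by (cases "i = j") auto
qed

text \<open>A binary tree: the leaves are variables, and each inner node is a column whose two sides
  lie in the two subtrees that it joins. Exchanging \<open>U\<close> and \<open>V\<close> covers the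
  opposite orientation of a column.\<close>

inductive glued :: "('j \<Rightarrow> 'v set) \<Rightarrow> ('j \<Rightarrow> 'v set) \<Rightarrow> 'v set \<Rightarrow> 'j set \<Rightarrow> bool" for P N where
  single: "glued P N {v} {}"
| glue: "glued P N U D \<Longrightarrow> glued P N V E \<Longrightarrow> U \<inter> V = {} \<Longrightarrow>
    P j \<noteq> {} \<Longrightarrow> N j \<noteq> {} \<Longrightarrow> P j \<subseteq> U \<Longrightarrow> N j \<subseteq> V \<Longrightarrow> glued P N (U \<union> V) (insert j (D \<union> E))"

text \<open>\<open>B\<close> is the current partition into glued blocks and \<open>C\<close> the set
  of columns still to be used. Two blocks joined by a column are merged until one block is left; the
  bound on the columns mixed on a union of blocks is the invariant that guarantees such a
  pair.\<close>

lemma glued_blocks: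
  fixes P N :: "'j \<Rightarrow> 'v set"
  assumes "finite B" "finite C" "card B = card C + 1" "\<And>U. U \<in> B \<Longrightarrow> glued P N U (f U)"
    and "pairwise disjnt B" "C \<union> \<Union>(f ` B) = J"
    and "\<And>j. j \<in> C \<Longrightarrow> P j \<noteq> {} \<and> N j \<noteq> {} \<and> P j \<union> N j \<subseteq> \<Union>B"
    and "\<And>R. R \<subseteq> B \<Longrightarrow> R \<noteq> {} \<Longrightarrow> card {j\<in>C. mixed P N (\<Union>R) j} < card R"
  shows "glued P N (\<Union>B) J"
  using assms
proof (induction "card C" arbitrary: B C f)
  case 0
  then have "card B = 1" "C = {}" by auto
  then obtain U where "B = {U}" by (auto simp: card_1_singleton_iff)
  then show ?case using 0(5)[of U] 0(7) \<open>C = {}\<close> by auto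
next
  case (Suc n)
  note pre = Suc.prems
  \<comment> \<open>The bound for all blocks but \<open>U\<close> leaves a column that is not mixed
    on their union, so one of its sides lies within \<open>U\<close>.\<close>
  have "\<exists>j\<in>C. P j \<subseteq> U \<or> N j \<subseteq> U" if U: "U \<in> B" for U
  proof (rule ccontr)
    assume "\<not> ?thesis"
    then have no: "\<not> P j \<subseteq> U" "\<not> N j \<subseteq> U" if "j \<in> C" for j using that by auto
    have "mixed P N (\<Union>(B - {U})) j" if "j \<in> C" for j
      using no[OF that] pre(7)[OF that] unfolding mixed_def by blast
    then have "{j\<in>C. mixed P N (\<Union>(B - {U})) j} = C" by auto
    moreover have "card (B - {U}) = card C" using U pre(1,3) by simp
    moreover have "B - {U} \<noteq> {}" using calculation(2) Suc.hyps(2) by (metis card.empty nat.distinct(1))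
    ultimately show False using pre(8)[of "B - {U}"] by auto
  qed
  then obtain s where s: "\<And>U. U \<in> B \<Longrightarrow> s U \<in> C \<and> (P (s U) \<subseteq> U \<or> N (s U) \<subseteq> U)" by metis
  \<comment> \<open>Pigeonhole: there are more blocks than columns, so two blocks share a column.
    Its sides are nonempty and the blocks disjoint, so one side lies in each block.\<close>
  have "\<not> inj_on s B"
  proof
    assume "inj_on s B"
    then have "card B \<le> card C" by (rule card_inj_on_le) (use s pre(2) in auto)
    then show False using pre(3) by simp
  qed
  then obtain U V where UV: "U \<in> B" "V \<in> B" "U \<noteq> V" "s U = s V" by (auto simp: inj_on_def)
  define j where "j = s U"
  have jC: "j \<in> C" using s UV j_def by auto
  have dis: "U \<inter> V = {}" using pre(5) UV by (auto simp: pairwise_def disjnt_def)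
  have ne: "P j \<noteq> {}" "N j \<noteq> {}" using pre(7)[OF jC] by auto
  have "\<not> (P j \<subseteq> U \<and> P j \<subseteq> V)" "\<not> (N j \<subseteq> U \<and> N j \<subseteq> V)" using ne dis by blast+
  moreover have "P j \<subseteq> U \<or> N j \<subseteq> U" "P j \<subseteq> V \<or> N j \<subseteq> V"
    using s[OF UV(1)] s[OF UV(2)] UV(4) by (simp_all add: j_def)
  ultimately have "(P j \<subseteq> U \<and> N j \<subseteq> V) \<or> (P j \<subseteq> V \<and> N j \<subseteq> U)" by argo
  then obtain U V where UV: "U \<in> B" "V \<in> B" "U \<noteq> V" "P j \<subseteq> U" "N j \<subseteq> V" using UV by metis
  have dis: "U \<inter> V = {}" using pre(5) UV by (auto simp: pairwise_def disjnt_def)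
  define W where "W = U \<union> V"
  define B' where "B' = insert W (B - {U, V})"
  define f' where "f' = f(W := insert j (f U \<union> f V))"
  have W: "W \<notin> B"
  proof
    assume W: "W \<in> B"
    have "U \<noteq> {}" "V \<noteq> {}" using UV ne by auto
    then have "W \<noteq> U" "W \<inter> U \<noteq> {}" using dis by (auto simp: W_def)
    then show False
      using pre(5) UV(1) W by (auto simp: pairwise_def disjnt_def)
  qed
  have UB: "\<Union>B' = \<Union>B" using UV(1,2) by (auto simp: B'_def W_def)
  have "glued P N (\<Union>B') J"
  proof (rule Suc.hyps(1))
    show "n = card (C - {j})" using Suc.hyps(2) jC pre(2) by simp
    show "finite B'" "finite (C - {j})" using pre by (auto simp: B'_def)
    have "card (B - {U, V}) = card B - 2"
      using UV by (subst card_Diff_subset) auto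
    moreover have "card B \<ge> 2" using pre(3) Suc.hyps(2) by simp
    ultimately show "card B' = card (C - {j}) + 1"
      using W pre(1,3) jC Suc.hyps(2) pre(2) by (simp add: B'_def)
    show "glued P N Z (f' Z)" if "Z \<in> B'" for Z
    proof (cases "Z = W")
      case True
      have "glued P N (U \<union> V) (insert j (f U \<union> f V))"
        by (rule glue) (use UV dis pre(4) pre(7)[OF jC] in auto)
      then show ?thesis using True by (simp add: f'_def W_def)
    next
      case False
      then show ?thesis using that pre(4) by (auto simp: B'_def f'_def)
    qed
    show "pairwise disjnt B'"
      unfolding B'_def
      by (rule pairwise_insert[THEN iffD2])
         (use pre(5) UV in \<open>auto simp: pairwise_def disjnt_def W_def\<close>)
    have "f' ` (B - {U, V}) = f ` (B - {U, V})" using W by (auto simp: f'_def)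
    moreover have "f' W = insert j (f U \<union> f V)" by (simp add: f'_def)
    ultimately have "\<Union>(f' ` B') = insert j (f U \<union> f V) \<union> \<Union>(f ` (B - {U, V}))"
      by (simp add: B'_def)
    also have "\<dots> = insert j (\<Union>(f ` B))" using UV(1,2) by auto
    finally show "C - {j} \<union> \<Union>(f' ` B') = J" using pre(6) jC by auto
    show "P i \<noteq> {} \<and> N i \<noteq> {} \<and> P i \<union> N i \<subseteq> \<Union>B'" if "i \<in> C - {j}" for i
      using pre(7)[of i] that unfolding UB by auto
    fix R assume R: "R \<subseteq> B'" "R \<noteq> {}"
    have finR: "finite R" using R(1) pre(1) by (auto simp: B'_def intro: finite_subset)
    show "card {i \<in> C - {j}. mixed P N (\<Union>R) i} < card R"
    proof (cases "W \<in> R")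
      case False
      then have "R \<subseteq> B" using R(1) by (auto simp: B'_def)
      then have "card {i\<in>C. mixed P N (\<Union>R) i} < card R" using pre(8) R(2) by blast
      moreover have "card {i \<in> C - {j}. mixed P N (\<Union>R) i} \<le> card {i\<in>C. mixed P N (\<Union>R) i}"
        by (rule card_mono) (use pre(2) in auto)
      ultimately show ?thesis by simp
    next
      case True
      \<comment> \<open>Splitting the merged block adds one block to \<open>R\<close>, and
        \<open>j\<close> is mixed on the union. So the old bound for \<open>R'\<close>, with
        \<open>j\<close> removed from the count, is the new bound for \<open>R\<close>.\<close>
      define R' where "R' = {U, V} \<union> (R - {W})"
      have R': "R' \<subseteq> B" "R' \<noteq> {}" using R(1) UV by (auto simp: R'_def B'_def)
      have UR: "\<Union>R' = \<Union>R" using True by (auto simp: R'_def W_def)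
      have "U \<notin> R" "V \<notin> R" using R(1) UV(1,2) W by (auto simp: B'_def)
      then have "card R' = card (R - {W}) + 2"
        using UV(3) finR by (simp add: R'_def)
      also have "\<dots> = card R + 1" using True finR by (metis Suc_eq_plus1 add_2_eq_Suc' card_Suc_Diff1)
      finally have "card R' = card R + 1" .
      moreover have "card {i\<in>C. mixed P N (\<Union>R) i} < card R'" using pre(8)[OF R'] UR by simp
      moreover have "U \<union> V \<subseteq> \<Union>R" using True by (auto simp: W_def)
      then have "mixed P N (\<Union>R) j"
        using UV(4,5) ne unfolding mixed_def by blast
      then have "{i\<in>C. mixed P N (\<Union>R) i} = insert j {i \<in> C - {j}. mixed P N (\<Union>R) i}"
        using jC by auto
      then have "card {i\<in>C. mixed P N (\<Union>R) i} = Suc (card {i \<in> C - {j}. mixed P N (\<Union>R) i})"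
        using pre(2) by simp
      ultimately show ?thesis by simp
    qed
  qed
  then show ?case unfolding UB .
qed

text \<open>The merging starts from singletons, whose unions are arbitrary sets of variables; for
  these \<open>card_mixed_less\<close> is the required invariant.\<close>

lemma glued_UNIV:
  fixes P N :: "'j \<Rightarrow> 'v::finite set"
  assumes C: "finite C" "card C = CARD('v) - 1"
    and empty: "\<And>j. j \<in> C \<Longrightarrow> P j = {} \<longleftrightarrow> N j = {}"
    and separated: "\<And>T. T \<noteq> {} \<Longrightarrow> T \<noteq> UNIV \<Longrightarrow> \<exists>j\<in>C. (P j \<subseteq> T) \<noteq> (N j \<subseteq> T)"
  shows "glued P N UNIV C"
proof -
  let ?B = "range (\<lambda>v::'v. {v})"
  have cB: "card R = card (\<Union>R)" if "R \<subseteq> ?B" for R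
  proof -
    from that obtain A where "R = (\<lambda>v. {v}) ` A" by (auto simp: subset_image_iff)
    then show ?thesis by (simp add: card_image)
  qed
  have "glued P N (\<Union>?B) C"
  proof (rule glued_blocks[where C = C and f = "\<lambda>_. {}"])
    have "card ?B = CARD('v)" using cB[of ?B] by simp
    moreover have "CARD('v) > 0" by simp
    ultimately show "card ?B = card C + 1" using C(2) by linarith
    show "P j \<noteq> {} \<and> N j \<noteq> {} \<and> P j \<union> N j \<subseteq> \<Union>?B" if "j \<in> C" for j
      using column_nonempty[of C P N j, OF C empty separated that] by auto
    show "card {j\<in>C. mixed P N (\<Union>R) j} < card R" if "R \<subseteq> ?B" "R \<noteq> {}" for R
    proof -
      have "\<Union>R \<noteq> {}" using that by auto
      from card_mixed_less[of C P N, OF C empty separated this] show ?thesis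
        using cB[OF that(1)] by simp
    qed
  qed (use C(1) in \<open>auto simp: pairwise_def intro: glued.single\<close>)
  then show ?thesis by simp
qed

section \<open>Congruences on exponent vectors\<close>

definition supp :: "nat ^ 's \<Rightarrow> 's set" where
  "supp x = {i. x $ i \<noteq> 0}"

definition restr :: "'s set \<Rightarrow> nat ^ 's \<Rightarrow> nat ^ 's" where
  "restr U x = (\<chi> i. if i \<in> U then x $ i else 0)"

lemma restr_add: "restr U (x + y) = restr U x + restr U y"
  by (simp add: restr_def vec_eq_iff)

lemma restr_of_nat_mult: "restr U (of_nat k * x) = of_nat k * restr U x"
  by (simp add: restr_def vec_eq_iff)

lemma restr_id: "supp x \<subseteq> U \<Longrightarrow> restr U x = x"
  by (auto simp: restr_def vec_eq_iff supp_def)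

lemma restr_disjoint: "supp x \<inter> U = {} \<Longrightarrow> restr U x = 0"
  by (auto simp: restr_def vec_eq_iff supp_def)

lemma restr_Compl: "restr U x + restr (- U) x = x"
  by (simp add: restr_def vec_eq_iff)

text \<open>The congruence on the additive monoid of exponent vectors generated by the pairs
  \<open>(p j, q j)\<close> with \<open>j\<close> in \<open>D\<close>. Translation by
  \<open>c\<close> is built into \<open>gen\<close>, so compatibility with addition follows.\<close>

inductive moncong :: "('j \<Rightarrow> nat ^ 's::finite) \<Rightarrow> ('j \<Rightarrow> nat ^ 's) \<Rightarrow> 'j set \<Rightarrow> nat ^ 's \<Rightarrow> nat ^ 's \<Rightarrow> bool"
  for p q D where
  gen: "j \<in> D \<Longrightarrow> moncong p q D (p j + c) (q j + c)"
| refl: "moncong p q D x x"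
| sym: "moncong p q D x y \<Longrightarrow> moncong p q D y x"
| trans: "moncong p q D x y \<Longrightarrow> moncong p q D y z \<Longrightarrow> moncong p q D x z"

lemma moncong_add_right: "moncong p q D x y \<Longrightarrow> moncong p q D (x + z) (y + z)"
  by (induction rule: moncong.induct)
     (auto simp: add.assoc intro: moncong.gen moncong.refl moncong.sym moncong.trans)

lemma moncong_add:
  assumes "moncong p q D x y" "moncong p q D u v"
  shows "moncong p q D (x + u) (y + v)"
  using moncong_add_right[OF assms(1), of u] moncong_add_right[OF assms(2), of y]
  by (metis add.commute moncong.trans)

lemma moncong_mono: "moncong p q D x y \<Longrightarrow> D \<subseteq> E \<Longrightarrow> moncong p q E x y"
  by (induction rule: moncong.induct)
     (auto intro: moncong.gen moncong.refl moncong.sym moncong.trans)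

text \<open>Projection to the coordinates in \<open>U\<close> fixes the generators from
  \<open>D\<close> and sends both sides of those from \<open>E\<close> to 0, so steps by the latter
  become trivial.\<close>

lemma moncong_restr:
  assumes "moncong p q (D \<union> E) x y"
    and D: "\<And>j. j \<in> D \<Longrightarrow> supp (p j) \<union> supp (q j) \<subseteq> U"
    and E: "\<And>j. j \<in> E \<Longrightarrow> (supp (p j) \<union> supp (q j)) \<inter> U = {}"
  shows "moncong p q D (restr U x) (restr U y)"
  using assms(1)
proof (induction rule: moncong.induct)
  case (gen j c)
  show ?case
  proof (cases "j \<in> D")
    case True
    then show ?thesis using D[OF True] by (simp add: restr_add restr_id moncong.gen)
  next
    case False
    then have "j \<in> E" using gen by simp
    from E[OF this] show ?thesis
      by (simp add: restr_add restr_disjoint Int_Un_distrib2 moncong.refl)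
  qed
qed (auto intro: moncong.refl moncong.sym moncong.trans)

definition cancellative :: "('j \<Rightarrow> nat ^ 's::finite) \<Rightarrow> ('j \<Rightarrow> nat ^ 's) \<Rightarrow> 'j set \<Rightarrow> bool" where
  "cancellative p q D \<longleftrightarrow> (\<forall>x y z. moncong p q D (x + z) (y + z) \<longrightarrow> moncong p q D x y)"

text \<open>Generators in disjoint sets of variables do not interact: the congruence is determined
  by its projections to \<open>U\<close> and to the complement, and each of them cancels.\<close>

lemma cancellative_Un:
  assumes "cancellative p q D" "cancellative p q E"
    and D: "\<And>j. j \<in> D \<Longrightarrow> supp (p j) \<union> supp (q j) \<subseteq> U"
    and E: "\<And>j. j \<in> E \<Longrightarrow> (supp (p j) \<union> supp (q j)) \<inter> U = {}"
  shows "cancellative p q (D \<union> E)"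
  unfolding cancellative_def
proof (intro allI impI)
  fix x y z assume *: "moncong p q (D \<union> E) (x + z) (y + z)"
  have "moncong p q D (restr U x + restr U z) (restr U y + restr U z)"
    using moncong_restr[OF * D E] by (simp add: restr_add)
  then have 1: "moncong p q D (restr U x) (restr U y)"
    using assms(1) by (auto simp: cancellative_def)
  have "moncong p q E (restr (- U) x + restr (- U) z) (restr (- U) y + restr (- U) z)"
    using moncong_restr[of p q E D _ _ "- U"] * D E by (fastforce simp: restr_add Un_commute)
  then have 2: "moncong p q E (restr (- U) x) (restr (- U) y)"
    using assms(2) by (auto simp: cancellative_def)
  have "moncong p q (D \<union> E) (restr U x + restr (- U) x) (restr U y + restr (- U) y)"
    by (rule moncong_add; rule moncong_mono) (use 1 2 in auto)
  then show "moncong p q (D \<union> E) x y" by (simp add: restr_Compl)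
qed

lemma moncong_iterate:
  assumes "j \<in> D"
  shows "moncong p q D (of_nat k * p j + c) (of_nat k * q j + c)"
proof (induction k arbitrary: c)
  case (Suc k)
  have "moncong p q D (p j + (of_nat k * p j + c)) (q j + (of_nat k * p j + c))"
    using assms by (rule moncong.gen)
  moreover have "moncong p q D (of_nat k * p j + (q j + c)) (of_nat k * q j + (q j + c))"
    by (rule Suc)
  ultimately show ?case
    by (auto simp: algebra_simps intro: moncong.trans)
qed (simp add: moncong.refl)

text \<open>When the two sides of a new pair involve separate sets of variables, all its
  applications can be collected into \<open>k\<close> uses in a single direction. This normal form
  lets cancellation pass to the larger congruence.\<close>

lemma moncong_glue:
  assumes canc: "cancellative p q (D \<union> E)"
    and D: "\<And>i. i \<in> D \<Longrightarrow> supp (p i) \<union> supp (q i) \<subseteq> U"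
    and E: "\<And>i. i \<in> E \<Longrightarrow> (supp (p i) \<union> supp (q i)) \<inter> U = {}"
    and j: "supp (p j) \<subseteq> U" "supp (q j) \<inter> U = {}"
  shows "moncong p q (insert j (D \<union> E)) x y \<longleftrightarrow>
    (\<exists>k. moncong p q (D \<union> E) (x + of_nat k * p j) (y + of_nat k * q j) \<or>
         moncong p q (D \<union> E) (y + of_nat k * p j) (x + of_nat k * q j))"
    (is "?l x y \<longleftrightarrow> (\<exists>k. ?r k x y \<or> ?r k y x)")
proof
  \<comment> \<open>Write V for the complement of U and x = x_U + x_V. The assumption projects to
    x_U + k p ~ y_U and x_V ~ y_V + k q. Hence x ~ x_U + y_V + k q ~ x_U + y_V + k p ~ y, where the
    middle step uses the new pair \<open>k\<close> times.\<close>
  have step: "?l x y" if r: "?r k x y" for k x y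
  proof -
    have 1: "moncong p q D (restr U x + of_nat k * p j) (restr U y)"
      using moncong_restr[OF r D E] j
      by (simp add: restr_add restr_of_nat_mult restr_id restr_disjoint)
    have "supp (p j) \<inter> - U = {}" "supp (q j) \<subseteq> - U" using j by auto
    moreover have "moncong p q (E \<union> D) (x + of_nat k * p j) (y + of_nat k * q j)"
      using r by (simp add: Un_commute)
    from moncong_restr[OF this, of "- U"]
    have "moncong p q E (restr (- U) (x + of_nat k * p j)) (restr (- U) (y + of_nat k * q j))"
      using D E by fastforce
    ultimately have 2: "moncong p q E (restr (- U) x) (restr (- U) y + of_nat k * q j)"
      by (simp add: restr_add restr_of_nat_mult restr_id restr_disjoint)
    have "?l (restr U x + restr (- U) x) (restr U x + (restr (- U) y + of_nat k * q j))"
      by (rule moncong_add[OF moncong.refl]) (rule moncong_mono[OF 2], auto)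
    then have "?l x (of_nat k * q j + (restr U x + restr (- U) y))"
      unfolding restr_Compl by (simp add: add_ac)
    moreover have "?l (of_nat k * q j + (restr U x + restr (- U) y)) (of_nat k * p j + (restr U x + restr (- U) y))"
      by (rule moncong.sym, rule moncong_iterate) simp
    moreover have "?l (restr U x + of_nat k * p j + restr (- U) y) (restr U y + restr (- U) y)"
      by (rule moncong_add[OF _ moncong.refl]) (rule moncong_mono[OF 1], auto)
    then have "?l (of_nat k * p j + (restr U x + restr (- U) y)) y"
      unfolding restr_Compl by (simp add: add_ac)
    ultimately show ?thesis by (meson moncong.trans)
  qed
  assume "\<exists>k. ?r k x y \<or> ?r k y x"
  then show "?l x y" using step moncong.sym by metis
next
  \<comment> \<open>Conversely, the right-hand side contains the generators and is an equivalence
    relation. For transitivity, \<open>up\<close> composes two relations of the same direction,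
    while \<open>peak\<close> and \<open>valley\<close> compose opposite directions by cancelling
    the smaller number of uses.\<close>
  have cancel: "moncong p q (D \<union> E) u v" if "moncong p q (D \<union> E) (u + w) (v + w)" for u v w
    using canc that by (auto simp: cancellative_def)
  have distr: "x + of_nat (k + l) * y = x + of_nat l * y + of_nat k * y"
      "x + of_nat k * y + of_nat l * z = x + of_nat l * z + of_nat k * y" for k l :: nat and x y z :: "nat ^ 'b"
    by (simp_all add: distrib_right add_ac)
  have up: "?r (k + l) x z" if "?r k x y" "?r l y z" for k l x y z
  proof -
    have "moncong p q (D \<union> E) (x + of_nat k * p j + of_nat l * p j) (y + of_nat k * q j + of_nat l * p j)"
      using that(1) by (rule moncong_add_right)
    also have "y + of_nat k * q j + of_nat l * p j = y + of_nat l * p j + of_nat k * q j"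
      by (rule distr)
    finally have "moncong p q (D \<union> E) (x + of_nat k * p j + of_nat l * p j) (y + of_nat l * p j + of_nat k * q j)" .
    moreover have "moncong p q (D \<union> E) (y + of_nat l * p j + of_nat k * q j) (z + of_nat l * q j + of_nat k * q j)"
      using that(2) by (rule moncong_add_right)
    ultimately have "moncong p q (D \<union> E) (x + of_nat k * p j + of_nat l * p j) (z + of_nat l * q j + of_nat k * q j)"
      by (rule moncong.trans)
    then show ?thesis unfolding distr(1) distr(2)[of x k _ l] .
  qed
  have peak: "?r k x z" if "?r (k + l) x y" "?r l z y" for k l x y z
  proof -
    have "moncong p q (D \<union> E) (x + of_nat (k + l) * p j) (y + of_nat l * q j + of_nat k * q j)"
      using that(1) unfolding distr(1)[of y] distr(1)[of x] .
    moreover have "moncong p q (D \<union> E) (y + of_nat l * q j + of_nat k * q j) (z + of_nat l * p j + of_nat k * q j)"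
      by (rule moncong_add_right[OF moncong.sym[OF that(2)]])
    ultimately have "moncong p q (D \<union> E) (x + of_nat (k + l) * p j) (z + of_nat l * p j + of_nat k * q j)"
      by (rule moncong.trans)
    then have "moncong p q (D \<union> E) ((x + of_nat k * p j) + of_nat l * p j) ((z + of_nat k * q j) + of_nat l * p j)"
      by (simp add: algebra_simps)
    then show ?thesis by (rule cancel)
  qed
  have valley: "?r k z x" if "?r (k + l) y x" "?r l y z" for k l x y z
  proof -
    have "moncong p q (D \<union> E) (z + of_nat l * q j + of_nat k * p j) (y + of_nat l * p j + of_nat k * p j)"
      by (rule moncong_add_right[OF moncong.sym[OF that(2)]])
    moreover have "moncong p q (D \<union> E) (y + of_nat l * p j + of_nat k * p j) (x + of_nat (k + l) * q j)"
      using that(1) unfolding distr(1)[of y] distr(1)[of x] .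
    ultimately have "moncong p q (D \<union> E) (z + of_nat l * q j + of_nat k * p j) (x + of_nat (k + l) * q j)"
      by (rule moncong.trans)
    then have "moncong p q (D \<union> E) ((z + of_nat k * p j) + of_nat l * q j) ((x + of_nat k * q j) + of_nat l * q j)"
      by (simp add: algebra_simps)
    then show ?thesis by (rule cancel)
  qed
  assume "?l x y"
  then show "\<exists>k. ?r k x y \<or> ?r k y x"
  proof (induction rule: moncong.induct)
    case (gen i c)
    show ?case
    proof (cases "i = j")
      case True
      \<comment> \<open>The new pair appears in reversed order: after one use both sides are
        \<open>p j + q j + c\<close>.\<close>
      have "?r 1 (q j + c) (p j + c)" by (simp add: add_ac moncong.refl)
      then show ?thesis using True by blast
    next
      case False
      then have "?r 0 (p i + c) (q i + c)" using gen by (auto intro: moncong.gen)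
      then show ?thesis by blast
    qed
  next
    case (refl x)
    have "?r 0 x x" by (simp add: moncong.refl)
    then show ?case by blast
  next
    case (sym x y)
    then show ?case by blast
  next
    case (trans x y z)
    then obtain k l where kl: "?r k x y \<or> ?r k y x" "?r l y z \<or> ?r l z y" by blast
    then consider "?r k x y" "?r l y z" | "?r l z y" "?r k y x"
      | "?r k x y" "?r l z y" | "?r k y x" "?r l y z" by blast
    then show ?case
    proof cases
      case 3
      show ?thesis
      proof (cases "l \<le> k")
        case True
        then obtain d where "k = d + l" by (metis le_add_diff_inverse2)
        then have "?r d x z" using 3 peak by metis
        then show ?thesis by blast
      next
        case False
        then obtain d where "l = d + k" by (metis le_add_diff_inverse2 nat_le_linear)
        then have "?r d z x" using 3 peak by metis
        then show ?thesis by blast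
      qed
    next
      case 4
      show ?thesis
      proof (cases "l \<le> k")
        case True
        then obtain d where "k = d + l" by (metis le_add_diff_inverse2)
        then have "?r d z x" using 4 valley by metis
        then show ?thesis by blast
      next
        case False
        then obtain d where "l = d + k" by (metis le_add_diff_inverse2 nat_le_linear)
        then have "?r d x z" using 4 valley by metis
        then show ?thesis by blast
      qed
    qed (use up in blast)+
  qed
qed

lemma glued_supp:
  assumes "glued P N U D" "j \<in> D"
  shows "P j \<union> N j \<subseteq> U"
  using assms by (induction) auto

text \<open>Induction along the tree. Without pairs the congruence is equality. At a node the normal
  form translates a relation between \<open>x + z\<close> and \<open>y + z\<close> into the
  congruence of the two subtrees, where \<open>z\<close> can be cancelled.\<close>

lemma glued_cancellative:
  assumes "glued (\<lambda>j. supp (p j)) (\<lambda>j. supp (q j)) U D"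
  shows "cancellative p q D"
  using assms
proof (induction rule: glued.induct)
  case (single v)
  have "moncong p q {} x y \<longleftrightarrow> x = y" for x y
  proof
    show "moncong p q {} x y \<Longrightarrow> x = y" by (induction rule: moncong.induct) auto
  qed (simp add: moncong.refl)
  then show ?case by (simp add: cancellative_def)
next
  case (glue U D V E j)
  have D: "supp (p i) \<union> supp (q i) \<subseteq> U" if "i \<in> D" for i
    using glued_supp[OF glue.hyps(1) that] .
  have E: "(supp (p i) \<union> supp (q i)) \<inter> U = {}" if "i \<in> E" for i
    using glued_supp[OF glue.hyps(2) that] glue.hyps(3) by blast
  have c: "cancellative p q (D \<union> E)" by (rule cancellative_Un[OF glue.IH D E])
  have "supp (q j) \<inter> U = {}" using glue.hyps(3,7) by blast
  note iff = moncong_glue[OF c D E glue.hyps(6) this]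
  have rearr: "moncong p q (D \<union> E) (x + of_nat k * p j) (y + of_nat k * q j)"
    if "moncong p q (D \<union> E) (x + z + of_nat k * p j) (y + z + of_nat k * q j)" for x y z k
  proof -
    have "moncong p q (D \<union> E) ((x + of_nat k * p j) + z) ((y + of_nat k * q j) + z)"
      using that by (simp add: add_ac)
    then show ?thesis using c unfolding cancellative_def by blast
  qed
  show ?case
    unfolding cancellative_def
  proof (intro allI impI)
    fix x y z assume "moncong p q (insert j (D \<union> E)) (x + z) (y + z)"
    then obtain k where
      "moncong p q (D \<union> E) (x + z + of_nat k * p j) (y + z + of_nat k * q j) \<or>
       moncong p q (D \<union> E) (y + z + of_nat k * p j) (x + z + of_nat k * q j)"
      using iff[THEN iffD1] by blast
    then show "moncong p q (insert j (D \<union> E)) x y"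
      by (intro iff[THEN iffD2] exI[of _ k]) (auto dest: rearr)
  qed
qed

section \<open>Lower bound for the height\<close>

text \<open>If \<open>m\<close> and \<open>k\<close> are the least indices of coefficients of
  \<open>f\<close> and \<open>g\<close> outside \<open>P\<close>, then modulo \<open>P\<close> the
  coefficient of \<open>f * g\<close> at \<open>m + k\<close> is the product of these two, hence not
  in \<open>P\<close>.\<close>

lemma primeideal_poly_coeffs:
  fixes P :: "'a::comm_ring_1 set"
  assumes P: "primeideal P ring_of_type_algebra"
  shows "primeideal {f :: 'a poly. \<forall>n. Polynomial.coeff f n \<in> P} ring_of_type_algebra"
proof -
  have I: "ideal P ring_of_type_algebra" using P by (simp add: primeideal_type_iff)
  have I': "0 \<in> P" "\<And>x y. x \<in> P \<Longrightarrow> y \<in> P \<Longrightarrow> x + y \<in> P"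
    using I by (auto simp: ideal_type_iff)
  have "ideal {f :: 'a poly. \<forall>n. Polynomial.coeff f n \<in> P} ring_of_type_algebra"
    using I' by (auto simp: ideal_type_iff coeff_mult intro!: ideal_sum[OF I] ideal_mult(1)[OF I])
  moreover have "\<forall>n. Polynomial.coeff f n \<in> P"
    if prod: "\<forall>n. Polynomial.coeff (f * g) n \<in> P" and g: "\<exists>n. Polynomial.coeff g n \<notin> P"
    for f g :: "'a poly"
  proof (rule ccontr)
    assume "\<not> (\<forall>n. Polynomial.coeff f n \<in> P)"
    then have f: "\<exists>n. Polynomial.coeff f n \<notin> P" by blast
    define m where "m = (LEAST n. Polynomial.coeff f n \<notin> P)"
    define k where "k = (LEAST n. Polynomial.coeff g n \<notin> P)"
    have m: "Polynomial.coeff f m \<notin> P" "\<And>n. n < m \<Longrightarrow> Polynomial.coeff f n \<in> P"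
      using LeastI_ex[OF f] not_less_Least unfolding m_def by blast+
    have k: "Polynomial.coeff g k \<notin> P" "\<And>n. n < k \<Longrightarrow> Polynomial.coeff g n \<in> P"
      using LeastI_ex[OF g] not_less_Least unfolding k_def by blast+
    let ?t = "\<lambda>i. Polynomial.coeff f i * Polynomial.coeff g (m + k - i)"
    have "(\<Sum>i\<in>{..m + k} - {m}. ?t i) \<in> P"
    proof (rule ideal_sum[OF I])
      fix i assume "i \<in> {..m + k} - {m}"
      then consider "i < m" | "m + k - i < k" by force
      then show "?t i \<in> P"
        by cases (use m(2) k(2) ideal_mult[OF I] in auto)
    qed
    moreover have "Polynomial.coeff (f * g) (m + k) = ?t m + (\<Sum>i\<in>{..m + k} - {m}. ?t i)"
      unfolding coeff_mult by (rule sum.remove) auto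
    ultimately have "?t m \<in> P" using prod ideal_diff[OF I] by (metis add_diff_cancel_right')
    then show False using m(1) k(1) P by (auto simp: primeideal_type_iff)
  qed
  moreover have "\<exists>n. Polynomial.coeff (1 :: 'a poly) n \<notin> P"
    using P by (auto simp: primeideal_type_iff intro!: exI[of _ 0])
  ultimately show ?thesis unfolding primeideal_type_iff[of "Collect _"] by blast
qed

text \<open>The polynomial read as a univariate one in \<open>t_i\<close>. Its coefficients do not
  involve \<open>t_i\<close> but keep the same type, which avoids a type with one variable
  less.\<close>

definition expand :: "'s \<Rightarrow> ('k::field, 's::finite) mpoly \<Rightarrow> ('k, 's) mpoly poly" where
  "expand i = mpoly_hom.subst (\<lambda>c. [:const c:]) (\<lambda>j. if j = i then [:0, 1:] else [:indet j:])"

lemma mpoly_hom_expand: "mpoly_hom (\<lambda>c. [:const c:] :: ('k::field, 's::finite) mpoly poly)"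
  by unfold_locales (auto simp: const_simps one_pCons)

lemmas expand_diff = mpoly_hom.subst_diff[OF mpoly_hom_expand, where x = "\<lambda>j. if j = i then [:0, 1:] else [:indet j:]", folded expand_def]
  and expand_mult = mpoly_hom.subst_mult[OF mpoly_hom_expand, where x = "\<lambda>j. if j = i then [:0, 1:] else [:indet j:]", folded expand_def]
  and expand_1 = mpoly_hom.subst_1[OF mpoly_hom_expand, where x = "\<lambda>j. if j = i then [:0, 1:] else [:indet j:]", folded expand_def]
  and expand_indet = mpoly_hom.subst_indet[OF mpoly_hom_expand, where x = "\<lambda>j. if j = i then [:0, 1:] else [:indet j:]", folded expand_def]
  and primeideal_expand_vimage = mpoly_hom.primeideal_vimage[OF mpoly_hom_expand, where x = "\<lambda>j. if j = i then [:0, 1:] else [:indet j:]", folded expand_def]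
  for i

lemma expand_power: "expand i (f ^ n) = expand i f ^ n"
  by (induction n) (simp_all add: expand_1 expand_mult)

lemma poly_expand: "poly (expand i f) (indet i) = f"
proof -
  have "poly (expand i f) (indet i) = mpoly_hom.subst const indet f"
    unfolding expand_def mpoly_hom.subst_def[OF mpoly_hom_expand] mpoly_hom.subst_def[OF mpoly_hom_const]
    by (auto simp: poly_sum poly_prod intro!: sum.cong prod.cong)
  then show ?thesis by (simp add: mpoly_subst_id)
qed

text \<open>For a prime \<open>P\<close> this is the extension to the polynomial ring of the contraction of \<open>P\<close> to the
  subring of polynomials that do not involve \<open>t\<^sub>i\<close>.\<close>
definition drop_var :: "'s \<Rightarrow> ('k::field, 's::finite) mpoly set \<Rightarrow> ('k, 's) mpoly set" where
  "drop_var i P = {f. \<forall>n. Polynomial.coeff (expand i f) n \<in> P}"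

lemma primeideal_drop_var:
  assumes "primeideal P mpoly_ring"
  shows "primeideal (drop_var i P) mpoly_ring"
proof -
  have "drop_var i P = expand i -` {f. \<forall>n. Polynomial.coeff f n \<in> P}"
    by (auto simp: drop_var_def)
  then show ?thesis using primeideal_expand_vimage[OF primeideal_poly_coeffs[OF assms]] by simp
qed

text \<open>A polynomial is the value of its expansion at \<open>t_i\<close>, hence a combination of
  the coefficients of that expansion.\<close>

lemma drop_var_subset:
  assumes "ideal P mpoly_ring"
  shows "drop_var i P \<subseteq> P"
proof
  fix f assume "f \<in> drop_var i P"
  then have "(\<Sum>n\<le>Polynomial.degree (expand i f). Polynomial.coeff (expand i f) n * indet i ^ n) \<in> P"
    by (intro ideal_sum[OF assms] ideal_mult(2)[OF assms]) (simp add: drop_var_def)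
  then show "f \<in> P" by (simp add: poly_altdef[symmetric] poly_expand)
qed

lemma binomial_in_drop_var:
  fixes P :: "('k::field, 's::finite) mpoly set"
  assumes "ideal P mpoly_ring" "indet k ^ m - indet j ^ n \<in> P" "i \<noteq> k" "i \<noteq> j"
  shows "indet k ^ m - indet j ^ n \<in> drop_var i P"
proof -
  let ?f = "indet k ^ m - indet j ^ n :: ('k, 's) mpoly"
  have "expand i ?f = [:?f:]"
    using assms(3,4) by (simp add: expand_diff expand_power expand_indet poly_const_pow)
  moreover have "0 \<in> P" using assms(1) by (simp add: ideal_type_iff)
  ultimately show ?thesis
    using assms(2) by (simp add: drop_var_def coeff_pCons split: nat.split)
qed

text \<open>As a polynomial in \<open>t_k\<close> the binomial has coefficient 1 at degree
  \<open>m\<close>: since \<open>m > 0\<close>, the second term, which only affects degree 0, does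
  not interfere.\<close>

lemma binomial_notin_drop_var:
  fixes P :: "('k::field, 's::finite) mpoly set"
  assumes "primeideal P mpoly_ring" "m > 0" "k \<noteq> j"
  shows "indet k ^ m - indet j ^ n \<notin> drop_var k P"
proof -
  have "[:0, 1:] ^ m = Polynomial.monom (1 :: ('k, 's) mpoly) m" by (simp add: monom_altdef)
  then have "Polynomial.coeff (expand k (indet k ^ m - indet j ^ n :: ('k, 's) mpoly)) m = 1"
    using assms(2,3) by (auto simp: expand_diff expand_power expand_indet poly_const_pow coeff_pCons
      split: nat.splits)
  moreover have "1 \<notin> P" using assms(1) by (simp add: primeideal_type_iff)
  ultimately show ?thesis unfolding drop_var_def by (metis (mono_tags) mem_Collect_eq)
qed

text \<open>The chain is built from the top. Passing to \<open>drop_var i P\<close> loses the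
  binomial of \<open>i\<close>, so the inclusion is strict, but keeps the binomials of the other
  listed variables, to which the induction applies.\<close>

lemma prime_chain_of_binomials:
  fixes P :: "('k::field, 's::finite) mpoly set"
  assumes "primeideal P mpoly_ring" "distinct is" "j \<notin> set is"
    and "\<And>i. i \<in> set is \<Longrightarrow> \<exists>m n. m > 0 \<and> indet i ^ m - indet j ^ n \<in> P"
  shows "\<exists>Q. (\<forall>l\<le>length is. primeideal (Q l) mpoly_ring) \<and> (\<forall>l<length is. Q l \<subset> Q (Suc l)) \<and>
    Q (length is) = P"
  using assms
proof (induction "is" arbitrary: P)
  case Nil
  then show ?case by (intro exI[of _ "\<lambda>_. P"]) auto
next
  case (Cons i "is")
  have I: "ideal P mpoly_ring" using Cons.prems(1) by (simp add: primeideal_type_iff)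
  have "\<exists>m n. m > 0 \<and> indet i' ^ m - indet j ^ n \<in> drop_var i P" if "i' \<in> set is" for i'
    using Cons.prems that binomial_in_drop_var[OF I, of i' _ j _ i]
    by (metis distinct.simps(2) list.set_intros(1,2))
  then obtain Q where Q: "\<forall>l\<le>length is. primeideal (Q l) mpoly_ring"
    "\<forall>l<length is. Q l \<subset> Q (Suc l)" "Q (length is) = drop_var i P"
    using Cons.IH[OF primeideal_drop_var[OF Cons.prems(1)]] Cons.prems(2,3) by force
  obtain m n where "m > 0" "indet i ^ m - indet j ^ n \<in> P" using Cons.prems(4)[of i] by auto
  moreover have "indet i ^ m - indet j ^ n \<notin> drop_var i P"
    by (rule binomial_notin_drop_var) (use Cons.prems \<open>m > 0\<close> in auto)
  ultimately have "drop_var i P \<subset> P" using drop_var_subset[OF I] by blast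
  then show ?case
    using Q Cons.prems(1)
    by (intro exI[of _ "Q(length (i # is) := P)"]) (auto simp: less_Suc_eq le_Suc_eq)
qed

text \<open>Every prime over \<open>L\<close> contains the given binomials, so dropping the
  variables other than \<open>j\<close> one by one yields a chain of length s - 1 that ends in
  it.\<close>

lemma ideal_height_ge:
  fixes L :: "('k::field, 's::finite) mpoly set"
  assumes "\<And>i. i \<noteq> j \<Longrightarrow> \<exists>m n. m > 0 \<and> indet i ^ m - indet j ^ n \<in> L"
  shows "enat (CARD('s) - 1) \<le> ideal_height mpoly_ring L"
  unfolding ideal_height_def
proof (rule Inf_greatest)
  fix h assume "h \<in> {prime_height mpoly_ring P | P. primeideal P mpoly_ring \<and> L \<subseteq> P}"
  then have "\<exists>P. h = prime_height mpoly_ring P \<and> primeideal P mpoly_ring \<and> L \<subseteq> P"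
    by (rule CollectD)
  then obtain P where h: "h = prime_height mpoly_ring P" and P: "primeideal P mpoly_ring" "L \<subseteq> P"
    by (elim exE conjE)
  obtain "is" where is': "set is = UNIV - {j}" "distinct is" using finite_distinct_list[OF finite] by metis
  then have len: "length is = CARD('s) - 1" using distinct_card[of "is"] by simp
  have "\<exists>m n. m > 0 \<and> indet i ^ m - indet j ^ n \<in> P" if "i \<in> set is" for i
    using assms[of i] that P(2) is'(1) by (metis DiffD2 insertI1 subsetD)
  from prime_chain_of_binomials[OF P(1) is'(2) _ this]
  have "\<exists>Q. (\<forall>l\<le>length is. primeideal (Q l) mpoly_ring) \<and> (\<forall>l<length is. Q l \<subset> Q (Suc l)) \<and>
    Q (length is) = P"
    using is'(1) by simp
  then have "enat (length is) \<in> {enat n | n. \<exists>Q. (\<forall>l\<le>n. primeideal (Q l) mpoly_ring) \<and>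
    (\<forall>l<n. Q l \<subset> Q (Suc l)) \<and> Q n = P}"
    by (simp only: mem_Collect_eq enat.inject ex_simps simp_thms)
  then show "enat (CARD('s) - 1) \<le> h"
    unfolding h prime_height_def len by (rule Sup_upper)
qed

section \<open>Upper bound for the height\<close>

fun power_product :: "'a::comm_ring_1 list \<Rightarrow> nat list \<Rightarrow> 'a" where
  "power_product (x # xs) (e # es) = x ^ e * power_product xs es"
| "power_product _ _ = 1"

text \<open>Since \<open>x\<^sub>0 \<in> Q\<^sub>1 - Q\<^sub>0\<close>, the lowest power of \<open>x\<^sub>0\<close> can be cancelled from a relation modulo \<open>Q\<^sub>0\<close>, and the
  terms that still contain \<open>x\<^sub>0\<close> vanish modulo \<open>Q\<^sub>1\<close>: what remains is a relation between
  \<open>x\<^sub>1, x\<^sub>2, \<dots>\<close> modulo \<open>Q\<^sub>1\<close>.\<close>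
lemma chain_no_relation:
  fixes Q :: "nat \<Rightarrow> ('k::field, 's::finite) mpoly set"
  assumes "\<And>i. i \<le> length xs \<Longrightarrow> primeideal (Q i) mpoly_ring"
    and "\<And>i. i < length xs \<Longrightarrow> Q i \<subseteq> Q (Suc i) \<and> xs ! i \<in> Q (Suc i) \<and> xs ! i \<notin> Q i"
    and "finite E" "E \<noteq> {}" "\<And>e. e \<in> E \<Longrightarrow> length e = length xs \<and> c e \<noteq> 0"
  shows "(\<Sum>e\<in>E. const (c e) * power_product xs e) \<notin> Q 0"
  using assms
proof (induction xs arbitrary: Q E c)
  case Nil
  have "E = {[]}" using Nil.prems(4,5) by auto
  then have c: "c [] \<noteq> 0" using Nil.prems(5) by simp
  have "const (inverse (c [])) * const (c []) = (1 :: ('k, 's) mpoly)"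
    using c by (simp add: const_mult[symmetric] const_1)
  moreover have "ideal (Q 0) mpoly_ring" "1 \<notin> Q 0" using Nil.prems(1)[of 0] by (simp_all add: primeideal_type_iff)
  ultimately have "const (c []) \<notin> Q 0" using ideal_mult(1) by metis
  then show ?case using \<open>E = {[]}\<close> by simp
next
  case (Cons x xs)
  have prime: "primeideal (Q 0) mpoly_ring" "primeideal (Q 1) mpoly_ring"
    using Cons.prems(1)[of 0] Cons.prems(1)[of 1] by simp_all
  then have I1: "ideal (Q 1) mpoly_ring" by (simp add: primeideal_type_iff)
  have x: "Q 0 \<subseteq> Q 1" "x \<in> Q 1" "x \<notin> Q 0" using Cons.prems(2)[of 0] by simp_all
  define m where "m = Min (hd ` E)"
  have m: "m \<in> hd ` E" "\<And>e. e \<in> E \<Longrightarrow> m \<le> hd e"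
    unfolding m_def using Cons.prems(3,4) by (auto intro!: Min_in)
  define E' where "E' = {es. m # es \<in> E}"
  have cons: "e = hd e # tl e" "length (tl e) = length xs" if "e \<in> E" for e
    using Cons.prems(5)[OF that] by (cases e; simp)+
  have E: "{e \<in> E. hd e = m} = (#) m ` E'"
  proof (rule Set.set_eqI)
    fix e show "e \<in> {e \<in> E. hd e = m} \<longleftrightarrow> e \<in> (#) m ` E'"
      using cons(1)[of e] by (auto simp: E'_def)
  qed
  have fin: "finite E'"
  proof (rule finite_imageD)
    show "finite ((#) m ` E')" unfolding E[symmetric] using Cons.prems(3) by simp
  qed simp
  obtain e where e: "e \<in> E" "hd e = m" using m(1) by auto
  have "tl e \<in> E'" using e cons(1)[OF e(1)] by (simp add: E'_def)
  then have ne: "E' \<noteq> {}" by auto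
  define S where "S = (\<Sum>es\<in>E'. const (c (m # es)) * power_product xs es)"
  define R where "R = (\<Sum>e\<in>{e \<in> E. hd e \<noteq> m}. const (c e) * (x ^ (hd e - m - 1) * power_product xs (tl e)))"
  have "(\<Sum>e\<in>E. const (c e) * power_product (x # xs) e) =
    (\<Sum>e\<in>{e \<in> E. hd e = m}. const (c e) * power_product (x # xs) e) +
    (\<Sum>e\<in>{e \<in> E. hd e \<noteq> m}. const (c e) * power_product (x # xs) e)"
    using Cons.prems(3) by (subst sum.union_disjoint[symmetric]) (auto intro!: sum.cong)
  also have "(\<Sum>e\<in>{e \<in> E. hd e = m}. const (c e) * power_product (x # xs) e) = x ^ m * S"
    unfolding E S_def by (subst sum.reindex) (simp_all add: sum_distrib_left mult_ac)
  also have "(\<Sum>e\<in>{e \<in> E. hd e \<noteq> m}. const (c e) * power_product (x # xs) e) = x ^ m * (x * R)"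
    unfolding R_def sum_distrib_left
  proof (rule sum.cong[OF HOL.refl])
    fix e assume "e \<in> {e \<in> E. hd e \<noteq> m}"
    then have e: "e \<in> E" "m < hd e" using m(2)[of e] by auto
    then obtain k where k: "hd e = m + 1 + k" using less_iff_Suc_add[of m "hd e"] by auto
    obtain es where "e = (m + 1 + k) # es" using cons(1)[OF e(1)] k by metis
    then show "const (c e) * power_product (x # xs) e = x ^ m * (x * (const (c e) * (x ^ (hd e - m - 1) * power_product xs (tl e))))"
      by (simp add: power_add mult_ac)
  qed
  finally have sum: "(\<Sum>e\<in>E. const (c e) * power_product (x # xs) e) = x ^ m * (S + x * R)"
    by (simp add: distrib_left)
  show ?case
  proof
    assume "(\<Sum>e\<in>E. const (c e) * power_product (x # xs) e) \<in> Q 0"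
    then have "x ^ m \<in> Q 0 \<or> S + x * R \<in> Q 0"
      unfolding sum using prime(1) by (simp add: primeideal_type_iff)
    then have "S + x * R \<in> Q 1" using primeideal_power[OF prime(1)] x(1,3) by auto
    moreover have "x * R \<in> Q 1" using ideal_mult(2)[OF I1 x(2)] .
    ultimately have "S + x * R - x * R \<in> Q 1" by (rule ideal_diff[OF I1])
    then have "S \<in> Q 1" by simp
    moreover have "S \<notin> Q (Suc 0)"
      unfolding S_def
    proof (rule Cons.IH[of "\<lambda>i. Q (Suc i)" E' "\<lambda>es. c (m # es)"])
      show "primeideal (Q (Suc i)) mpoly_ring" if "i \<le> length xs" for i
        using Cons.prems(1)[of "Suc i"] that by simp
      show "Q (Suc i) \<subseteq> Q (Suc (Suc i)) \<and> xs ! i \<in> Q (Suc (Suc i)) \<and> xs ! i \<notin> Q (Suc i)"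
        if "i < length xs" for i
        using Cons.prems(2)[of "Suc i"] that by simp
      show "length es = length xs \<and> c (m # es) \<noteq> 0" if "es \<in> E'" for es
        using Cons.prems(5)[of "m # es"] that by (simp add: E'_def)
    qed (fact fin ne)+
    ultimately show False by simp
  qed
qed

section \<open>Algebraic dependence by counting monomials\<close>

definition box :: "nat \<Rightarrow> (nat ^ 's::finite) set" where
  "box d = {a. \<forall>i. a $ i \<le> d}"

lemma card_box: "finite (box d :: (nat ^ 's::finite) set)" "card (box d :: (nat ^ 's) set) = (d + 1) ^ CARD('s)"
proof -
  have "bij_betw vec_nth (box d :: (nat ^ 's) set) (PiE UNIV (\<lambda>_. {..d}))"
    by (rule bij_betwI[where g = vec_lambda]) (auto simp: box_def PiE_def Pi_def)
  then show "finite (box d :: (nat ^ 's) set)" "card (box d :: (nat ^ 's) set) = (d + 1) ^ CARD('s)"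
    by (simp_all add: bij_betw_finite bij_betw_same_card card_PiE finite_PiE)
qed

lemma keys_mult_box:
  assumes "Poly_Mapping.keys f \<subseteq> box d" "Poly_Mapping.keys g \<subseteq> box e"
  shows "Poly_Mapping.keys (f * g) \<subseteq> box (d + e)"
proof
  fix a assume "a \<in> Poly_Mapping.keys (f * g)"
  then obtain b c where "b \<in> Poly_Mapping.keys f" "c \<in> Poly_Mapping.keys g" "a = b + c"
    using keys_mult[of f g] by auto
  with assms have "b \<in> box d" "c \<in> box e" "a = b + c" by auto
  then show "a \<in> box (d + e)" by (simp add: box_def add_mono)
qed

lemma keys_power_box:
  assumes "Poly_Mapping.keys f \<subseteq> box d"
  shows "Poly_Mapping.keys (f ^ n) \<subseteq> box (n * d)"
proof (induction n)
  case 0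
  then show ?case by (simp add: box_def)
next
  case (Suc n)
  show ?case using keys_mult_box[OF assms Suc] by simp
qed

lemma keys_power_product_box:
  assumes "\<And>x. x \<in> set xs \<Longrightarrow> Poly_Mapping.keys x \<subseteq> box d" and "set es \<subseteq> {..n}"
  shows "Poly_Mapping.keys (power_product xs es :: ('k::field, 's::finite) mpoly) \<subseteq> box (length xs * (n * d))"
  using assms
proof (induction xs es rule: power_product.induct)
  case (1 x xs e es)
  have "e * d \<le> n * d" using "1.prems"(2) by simp
  then have "box (e * d) \<subseteq> (box (n * d) :: (nat ^ 's) set)" by (auto simp: box_def intro: order_trans)
  then have "Poly_Mapping.keys (x ^ e) \<subseteq> box (n * d)" using keys_power_box[of x d e] "1.prems"(1) by auto
  from keys_mult_box[OF this "1.IH"] "1.prems" show ?case by simp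
qed (simp_all add: box_def)

lemma in_span_monomials:
  "f \<in> mpoly.span (monomial ` Poly_Mapping.keys f)"
proof -
  have "(\<Sum>a\<in>Poly_Mapping.keys f. const (Poly_Mapping.lookup f a) * monomial a) \<in>
    mpoly.span (monomial ` Poly_Mapping.keys f)"
    by (intro mpoly.span_sum mpoly.span_scale mpoly.span_base imageI)
  then show ?thesis by (simp add: single_eq_const_mult[symmetric] mpoly_sum_single)
qed

text \<open>The power products with exponents at most \<open>N\<close> are indexed by
  \<open>(N + 1)^(s + 1)\<close> lists, but lie in the span of a box of monomials whose size only
  grows like \<open>N^s\<close>. For large \<open>N\<close> they are linearly dependent, unless two
  of them coincide, which is a relation as well.\<close>

lemma exists_relation:
  fixes xs :: "('k::field, 's::finite) mpoly list"
  assumes len: "length xs = CARD('s) + 1"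
  shows "\<exists>E c. finite E \<and> E \<noteq> {} \<and> (\<forall>e\<in>E. length e = length xs \<and> c e \<noteq> 0) \<and>
    (\<Sum>e\<in>E. const (c e) * power_product xs e) = 0"
proof -
  let ?s = "CARD('s)"
  have "finite (\<Union>x\<in>set xs. \<Union>a\<in>Poly_Mapping.keys x. range (($) a))" by simp
  then obtain d where d: "\<And>x a i. x \<in> set xs \<Longrightarrow> a \<in> Poly_Mapping.keys x \<Longrightarrow> a $ i \<le> d"
    by (subst (asm) finite_nat_set_iff_bounded_le) auto
  \<comment> \<open>This value bounds the size of the box \<open>B\<close> by
    \<open>N * (N + 1)^s\<close>, which is less than the number \<open>(N + 1)^(s + 1)\<close> of
    lists in \<open>Es\<close>.\<close>
  define N where "N = (length xs * d + 1) ^ ?s"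
  define B where "B = (box (length xs * (N * d)) :: (nat ^ 's) set)"
  define Es where "Es = {es. set es \<subseteq> {..N} \<and> length es = length xs}"
  have finEs: "finite Es" unfolding Es_def by (rule finite_lists_length_eq) simp
  have "length xs * (N * d) + 1 \<le> (length xs * d + 1) * (N + 1)"
    by (simp add: algebra_simps)
  then have "card B \<le> ((length xs * d + 1) * (N + 1)) ^ ?s"
    unfolding B_def card_box(2) by (rule power_mono) simp
  also have "\<dots> = N * (N + 1) ^ ?s" by (simp only: power_mult_distrib N_def)
  also have "\<dots> < (N + 1) * (N + 1) ^ ?s" by simp
  also have "\<dots> = card Es"
    unfolding Es_def using card_lists_length_eq[of "{..N}" "length xs"] len by simp
  finally have less: "card B < card Es" .
  have span: "power_product xs ` Es \<subseteq> mpoly.span (monomial ` B)"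
  proof
    fix f assume "f \<in> power_product xs ` Es"
    then obtain es where es: "f = power_product xs es" "set es \<subseteq> {..N}" by (auto simp: Es_def)
    have "Poly_Mapping.keys x \<subseteq> box d" if "x \<in> set xs" for x
      using d[OF that] by (auto simp: box_def)
    from keys_power_product_box[OF this es(2)] have "Poly_Mapping.keys f \<subseteq> B" by (simp add: B_def es(1))
    then have "mpoly.span (monomial ` Poly_Mapping.keys f) \<subseteq> mpoly.span (monomial ` B)"
      by (intro mpoly.span_mono image_mono)
    then show "f \<in> mpoly.span (monomial ` B)" using in_span_monomials[of f] by auto
  qed
  show ?thesis
  proof (cases "inj_on (power_product xs) Es")
    case False
    then obtain e e' where e: "e \<in> Es" "e' \<in> Es" "e \<noteq> e'" "power_product xs e = power_product xs e'"
      by (auto simp: inj_on_def)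
    let ?c = "\<lambda>es. if es = e then 1 else - 1 :: 'k"
    have "const 1 + const (- 1) = (0 :: ('k, 's) mpoly)"
      by (simp add: const_add[symmetric] const_0)
    then have "(\<Sum>es\<in>{e, e'}. const (?c es) * power_product xs es) = 0"
      using e(3) by (simp add: e(4) distrib_right[symmetric])
    then show ?thesis using e(1,2)
      by (intro exI[of _ "{e, e'}"] exI[of _ ?c]) (auto simp: Es_def)
  next
    case True
    have "finite B" by (simp add: B_def card_box)
    then have "finite (monomial ` B :: ('k, 's) mpoly set)" by simp
    moreover have "card (monomial ` B :: ('k, 's) mpoly set) < card (power_product xs ` Es)"
      using less card_image_le[OF \<open>finite B\<close>, of "monomial :: _ \<Rightarrow> ('k, 's) mpoly"] card_image[OF True] by linarith
    ultimately have "mpoly.dependent (power_product xs ` Es)"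
      using mpoly.independent_span_bound[OF _ _ span] by force
    then obtain u where u: "\<exists>v\<in>power_product xs ` Es. u v \<noteq> 0" "(\<Sum>v\<in>power_product xs ` Es. const (u v) * v) = 0"
      using mpoly.dependent_finite[of "power_product xs ` Es"] finEs by auto
    define E where "E = {e \<in> Es. u (power_product xs e) \<noteq> 0}"
    have "(\<Sum>e\<in>E. const (u (power_product xs e)) * power_product xs e) = (\<Sum>e\<in>Es. const (u (power_product xs e)) * power_product xs e)"
      unfolding E_def by (rule sum.mono_neutral_left) (auto simp: finEs const_0)
    also have "\<dots> = 0" using u(2) by (simp add: sum.reindex[OF True])
    finally have "(\<Sum>e\<in>E. const (u (power_product xs e)) * power_product xs e) = 0" .
    moreover have "finite E" "E \<noteq> {}" using u(1) finEs by (auto simp: E_def)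
    moreover have "length e = length xs \<and> u (power_product xs e) \<noteq> 0" if "e \<in> E" for e
      using that by (simp add: E_def Es_def)
    ultimately show ?thesis by (intro exI[of _ E] exI[of _ "\<lambda>e. u (power_product xs e)"]) simp
  qed
qed

text \<open>A longer chain would provide elements of \<open>Q (Suc i) - Q i\<close> for s + 1 values
  of \<open>i\<close>. Their algebraic relation has the value 0, an element of \<open>Q 0\<close>,
  which \<open>chain_no_relation\<close> excludes.\<close>

lemma prime_chain_length:
  fixes Q :: "nat \<Rightarrow> ('k::field, 's::finite) mpoly set"
  assumes prime: "\<And>i. i \<le> n \<Longrightarrow> primeideal (Q i) mpoly_ring"
    and chain: "\<And>i. i < n \<Longrightarrow> Q i \<subset> Q (Suc i)"
  shows "n \<le> CARD('s)"
proof (rule ccontr)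
  assume n: "\<not> ?thesis"
  define x where "x i = (SOME x. x \<in> Q (Suc i) \<and> x \<notin> Q i)" for i
  have x: "x i \<in> Q (Suc i) \<and> x i \<notin> Q i" if "i < n" for i
    unfolding x_def by (rule someI_ex) (use chain[OF that] in auto)
  define xs where "xs = map x [0..<CARD('s) + 1]"
  have len: "length xs = CARD('s) + 1" by (simp add: xs_def)
  from exists_relation[OF this] obtain E c where E: "finite E" "E \<noteq> {}"
    "\<forall>e\<in>E. length e = length xs \<and> c e \<noteq> (0::'k)" "(\<Sum>e\<in>E. const (c e) * power_product xs e) = 0"
    by (elim exE conjE)
  have "(\<Sum>e\<in>E. const (c e) * power_product xs e) \<notin> Q 0"
  proof (rule chain_no_relation)
    show "primeideal (Q i) mpoly_ring" if "i \<le> length xs" for i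
      using prime n that len by simp
    show "Q i \<subseteq> Q (Suc i) \<and> xs ! i \<in> Q (Suc i) \<and> xs ! i \<notin> Q i" if "i < length xs" for i
    proof -
      have "i < n" "xs ! i = x i" using that n len by (auto simp: xs_def simp del: upt_Suc)
      then show ?thesis using x[of i] chain[of i] by auto
    qed
  qed (use E in auto)
  moreover have "0 \<in> Q 0" using prime[of 0] by (simp add: primeideal_type_iff ideal_type_iff)
  ultimately show False using E(4) by simp
qed

section \<open>Weights and the monomial curve\<close>

definition binom :: "int ^ 's \<Rightarrow> ('k::field, 's::finite) mpoly" where
  "binom a = monomial (pos_part a) - monomial (neg_part a)"

lemma lattice_ideal_binom: "lattice_ideal \<L> = Idl\<^bsub>mpoly_ring\<^esub> (binom ` \<L>)"
  unfolding lattice_ideal_def binom_def image_def Bex_def by (simp add: conj_commute)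

definition wdeg :: "int ^ 's::finite \<Rightarrow> nat ^ 's \<Rightarrow> int" where
  "wdeg \<omega> a = (\<Sum>i\<in>UNIV. \<omega> $ i * int (a $ i))"

lemma wdeg_add: "wdeg \<omega> (a + b) = wdeg \<omega> a + wdeg \<omega> b"
  by (simp add: wdeg_def algebra_simps sum.distrib)

lemma wdeg_nonneg: "(\<And>i. \<omega> $ i > 0) \<Longrightarrow> wdeg \<omega> a \<ge> 0"
  unfolding wdeg_def by (intro sum_nonneg mult_nonneg_nonneg) (auto intro: less_imp_le)

lemma wdeg_pos:
  assumes "\<And>i. \<omega> $ i > 0" and "a \<noteq> 0"
  shows "wdeg \<omega> a > 0"
proof -
  obtain i where i: "a $ i > 0" using assms(2) by (auto simp: vec_eq_iff)
  have "0 < \<omega> $ i * int (a $ i)" using assms(1) i by simp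
  also have "\<dots> \<le> wdeg \<omega> a"
    unfolding wdeg_def using assms(1) by (intro member_le_sum) (auto simp: less_imp_le)
  finally show ?thesis .
qed

lemma wdeg_pos_neg_part:
  assumes "homogeneous_lattice \<omega> \<L>" and "a \<in> \<L>"
  shows "wdeg \<omega> (pos_part a) = wdeg \<omega> (neg_part a)"
proof -
  have "wdeg \<omega> (pos_part a) - wdeg \<omega> (neg_part a) = (\<Sum>i\<in>UNIV. \<omega> $ i * a $ i)"
    unfolding wdeg_def sum_subtractf[symmetric] right_diff_distrib[symmetric]
    by (rule sum.cong) (auto simp: pos_part_def neg_part_def)
  then show ?thesis using assms by (simp add: homogeneous_lattice_def)
qed

lemma mpoly_hom_pCons: "mpoly_hom (\<lambda>c :: 'k::field. [:c:])"
  by unfold_locales (auto simp: one_pCons)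

text \<open>The vanishing ideal of the monomial curve \<open>(T\<^bsup>\<omega>\<^sub>1\<^esup>, T\<^bsup>\<omega>\<^sub>2\<^esup>, \<dots>)\<close> is a prime that contains the
  lattice ideal and is strictly contained in the maximal ideal of the origin.\<close>
lemma ideal_height_lattice_ideal_le:
  fixes \<omega> :: "int ^ 's::finite" and \<L> :: "(int ^ 's) set"
  assumes omega: "\<And>i. \<omega> $ i > 0" and homog: "homogeneous_lattice \<omega> \<L>"
  shows "ideal_height mpoly_ring (lattice_ideal \<L> :: ('k::field, 's) mpoly set) \<le> enat (CARD('s) - 1)"
proof -
  define y :: "'s \<Rightarrow> 'k poly" where "y i = Polynomial.monom 1 (nat (\<omega> $ i))" for i
  define \<phi> where "\<phi> = mpoly_hom.subst (\<lambda>c::'k. [:c:]) y"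
  define P where "P = \<phi> -` {0}"
  define M where "M = (\<lambda>f :: ('k, 's) mpoly. eval_mpoly f 0) -` {0}"
  have P: "primeideal P mpoly_ring"
    unfolding P_def \<phi>_def
    by (rule mpoly_hom.primeideal_vimage[OF mpoly_hom_pCons])
       (simp add: primeideal_type_iff ideal_type_iff)
  have M: "primeideal M mpoly_ring"
    unfolding M_def eval_mpoly_eq_subst
    by (rule mpoly_hom.primeideal_vimage[OF mpoly_hom_id])
       (simp add: primeideal_type_iff ideal_type_iff)
  have eval: "eval_mpoly f 0 = poly (\<phi> f) 0" for f
  proof -
    have "poly (y i) 0 = 0" for i using omega by (simp add: y_def poly_monom)
    then show ?thesis
      by (simp add: \<phi>_def mpoly_hom.subst_def[OF mpoly_hom_pCons] eval_mpoly_def poly_sum poly_prod)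
  qed
  have "P \<subset> M"
  proof
    show "P \<subseteq> M" by (auto simp: P_def M_def eval)
    obtain i :: 's where True by simp
    have "eval_mpoly (indet i :: ('k, 's) mpoly) 0 = 0" by (simp add: eval_mpoly_indet)
    then have "indet i \<in> M" by (simp add: M_def)
    moreover have "\<phi> (indet i) \<noteq> 0"
      by (simp add: \<phi>_def mpoly_hom.subst_indet[OF mpoly_hom_pCons] y_def)
    then have "indet i \<notin> P" by (simp add: P_def)
    ultimately show "P \<noteq> M" by auto
  qed
  \<comment> \<open>On the curve \<open>t^a\<close> becomes the power of \<open>T\<close> whose
    exponent is the weight of \<open>a\<close>; the two monomials of a lattice binomial have equal
    weight, so the binomial vanishes there.\<close>
  have mono: "\<phi> (monomial a) = Polynomial.monom 1 (nat (wdeg \<omega> a))" for a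
  proof -
    have "(\<Prod>i\<in>A. y i ^ (a $ i)) = Polynomial.monom 1 (\<Sum>i\<in>A. nat (\<omega> $ i) * a $ i)" for A
      by (induction A rule: infinite_finite_induct)
         (simp_all add: y_def monom_power mult_monom mult.commute)
    moreover have w: "int (\<Sum>i\<in>UNIV. nat (\<omega> $ i) * a $ i) = wdeg \<omega> a"
      unfolding wdeg_def of_nat_sum using omega
      by (intro sum.cong) (auto simp: less_imp_le)
    ultimately show ?thesis
      by (simp add: \<phi>_def mpoly_hom.subst_monomial[OF mpoly_hom_pCons] del: of_nat_sum flip: w)
  qed
  have "binom a \<in> P" if "a \<in> \<L>" for a
  proof -
    have "\<phi> (binom a) = \<phi> (monomial (pos_part a)) - \<phi> (monomial (neg_part a))"
      unfolding binom_def \<phi>_def by (rule mpoly_hom.subst_diff[OF mpoly_hom_pCons])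
    then show ?thesis by (simp add: P_def mono wdeg_pos_neg_part[OF homog that])
  qed
  then have L: "lattice_ideal \<L> \<subseteq> P"
    unfolding lattice_ideal_binom using P by (intro Idl_subsetI) (auto simp: primeideal_type_iff)
  have "n \<le> CARD('s) - 1"
    if Q: "\<forall>i\<le>n. primeideal (Q i) mpoly_ring" "\<forall>i<n. Q i \<subset> Q (Suc i)" "Q n = P"
    for n and Q :: "nat \<Rightarrow> ('k, 's) mpoly set"
  proof -
    \<comment> \<open>\<open>M\<close> prolongs every chain ending in \<open>P\<close> by one prime.
      The longer chain has length at most s, whence the bound s - 1.\<close>
    define Q' where "Q' = Q(Suc n := M)"
    have "Suc n \<le> CARD('s)"
    proof (rule prime_chain_length[of _ Q'])
      show "primeideal (Q' i) mpoly_ring" if "i \<le> Suc n" for i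
        using that Q(1) M by (auto simp: Q'_def)
      show "Q' i \<subset> Q' (Suc i)" if "i < Suc n" for i
        using that Q(2,3) \<open>P \<subset> M\<close> by (cases "i = n") (auto simp: Q'_def)
    qed
    then show ?thesis by simp
  qed
  then have "prime_height mpoly_ring P \<le> enat (CARD('s) - 1)"
    unfolding prime_height_def by (intro Sup_least) auto
  moreover have "ideal_height mpoly_ring (lattice_ideal \<L> :: ('k, 's) mpoly set) \<le> prime_height mpoly_ring P"
    unfolding ideal_height_def using P L by (intro Inf_lower) auto
  ultimately show ?thesis by (rule order_trans[rotated])
qed

section \<open>Minimal generators of a lattice ideal\<close>

text \<open>Steinitz exchange modulo \<open>W\<close>: an element \<open>a\<close> of
  \<open>A\<close> outside \<open>W\<close> replaces an element of \<open>G\<close> and is absorbed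
  into the subspace, which leaves one generator less for the induction.\<close>

lemma (in vector_space) exchange_modulo:
  assumes "finite G" "subspace W" "A \<subseteq> span (G \<union> W)"
  shows "\<exists>B\<subseteq>A. finite B \<and> card B \<le> card G \<and> A \<subseteq> span (B \<union> W)"
  using assms
proof (induction "card G" arbitrary: G W)
  case 0
  then have "G = {}" by simp
  then show ?case using 0 by (intro exI[of _ "{}"]) simp
next
  case (Suc n)
  show ?case
  proof (cases "A \<subseteq> W")
    case True
    then show ?thesis using span_superset[of W] by (intro exI[of _ "{}"]) auto
  next
    case False
    then obtain a where a: "a \<in> A" "a \<notin> W" by auto
    \<comment> \<open>When elements of \<open>G\<close> are added to \<open>W\<close> one at a time,
      some \<open>g\<close> first puts \<open>a\<close> into the span; this one can be exchanged for
      \<open>a\<close>.\<close>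
    have "\<exists>g H. g \<in> G \<and> H \<subseteq> G - {g} \<and> a \<in> span (insert g (H \<union> W)) \<and> a \<notin> span (H \<union> W)"
      if "finite F" "a \<in> span (F \<union> W)" "F \<subseteq> G" for F
      using that
    proof (induction F rule: finite_induct)
      case empty
      then show ?case using a(2) span_eq_iff[THEN iffD2, OF Suc.prems(2)] by simp
    next
      case (insert g F)
      show ?case
      proof (cases "a \<in> span (F \<union> W)")
        case True
        then show ?thesis using insert.IH insert.prems by simp
      next
        case False
        then show ?thesis using insert.prems insert.hyps by (intro exI[of _ g] exI[of _ F]) auto
      qed
    qed
    moreover have "a \<in> span (G \<union> W)" using a(1) Suc.prems(3) by auto
    ultimately obtain g H where g: "g \<in> G" "H \<subseteq> G - {g}"
      "a \<in> span (insert g (H \<union> W))" "a \<notin> span (H \<union> W)"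
      using Suc.prems(1) by blast
    define W' where "W' = span (insert a W)"
    have W: "insert a W \<subseteq> W'" unfolding W'_def by (rule span_superset)
    have "g \<in> span (insert a (H \<union> W))" using in_span_insert[OF g(3,4)] .
    also have "\<dots> \<subseteq> span ((G - {g}) \<union> W')" by (rule span_mono) (use g(2) W in auto)
    finally have "G \<subseteq> span ((G - {g}) \<union> W')" using span_superset[of "(G - {g}) \<union> W'"] by auto
    moreover have "W \<subseteq> span ((G - {g}) \<union> W')" using W span_superset[of "(G - {g}) \<union> W'"] by auto
    ultimately have "span (G \<union> W) \<subseteq> span ((G - {g}) \<union> W')"
      by (intro span_minimal) auto
    then have A: "A \<subseteq> span ((G - {g}) \<union> W')" using Suc.prems(3) by auto
    have card: "card (G - {g}) = n" using Suc.hyps(2) g(1) Suc.prems(1) by simp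
    have "subspace W'" by (simp add: W'_def)
    from Suc.hyps(1)[OF card[symmetric] _ this A] Suc.prems(1)
    obtain B where B: "B \<subseteq> A" "finite B" "card B \<le> n" "A \<subseteq> span (B \<union> W')"
      using card by auto
    have "W' \<subseteq> span (insert a B \<union> W)"
      unfolding W'_def by (rule span_mono) auto
    moreover have "B \<subseteq> span (insert a B \<union> W)" using span_superset[of "insert a B \<union> W"] by auto
    ultimately have "span (B \<union> W') \<subseteq> span (insert a B \<union> W)"
      by (intro span_minimal) auto
    then have "A \<subseteq> span (insert a B \<union> W)" using B(4) by auto
    moreover have "card (insert a B) \<le> card G"
      using card_insert_le_m1[of "Suc n" B a] B(2,3) Suc.hyps(2) by simp
    ultimately show ?thesis using B(1,2) a(1) by (intro exI[of _ "insert a B"]) auto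
  qed
qed

text \<open>Multiplication by a polynomial is a linear combination of multiplications by monomials.
  This opens ideals to linear algebra.\<close>

lemma Idl_eq_span:
  "Idl\<^bsub>mpoly_ring\<^esub> F = mpoly.span {monomial e * f | e f. f \<in> F}" (is "_ = mpoly.span ?M")
proof
  have mono: "monomial e * g \<in> mpoly.span ?M" if "g \<in> mpoly.span ?M" for e g
    using that
  proof (induction rule: mpoly.span_induct_alt)
    case base
    then show ?case by (simp add: mpoly.span_zero)
  next
    case (step c x y)
    then obtain e' f where x: "x = monomial e' * f" "f \<in> F" by auto
    then have "monomial (e + e') * f \<in> ?M" by auto
    then have "const c * (monomial (e + e') * f) \<in> mpoly.span ?M"
      by (intro mpoly.span_scale mpoly.span_base)
    moreover have "monomial e * (const c * x + y) = const c * (monomial (e + e') * f) + monomial e * y"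
      by (simp add: x monomial_add algebra_simps)
    ultimately show ?case using step by (simp add: mpoly.span_add)
  qed
  have mult: "r * g \<in> mpoly.span ?M" if "g \<in> mpoly.span ?M" for r g
  proof (induction r rule: mpoly_induct)
    case (single a c)
    then show ?case
      using mpoly.span_scale[OF mono[OF that], of c a] by (simp add: single_eq_const_mult mult.assoc)
  qed (simp_all add: mpoly.span_zero mpoly.span_add distrib_right)
  show "Idl\<^bsub>mpoly_ring\<^esub> F \<subseteq> mpoly.span ?M"
  proof (rule Idl_subsetI)
    show "ideal (mpoly.span ?M) mpoly_ring"
      unfolding ideal_type_iff using mult by (intro conjI ballI allI mpoly.span_zero mpoly.span_add)
    show "F \<subseteq> mpoly.span ?M"
    proof
      fix f assume "f \<in> F"
      then have "monomial 0 * f \<in> ?M" by auto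
      then have "f \<in> ?M" by (simp add: monomial_0)
      then show "f \<in> mpoly.span ?M" by (rule mpoly.span_base)
    qed
  qed
  have I: "ideal (Idl\<^bsub>mpoly_ring\<^esub> F) mpoly_ring" by (rule ideal_Idl)
  show "mpoly.span ?M \<subseteq> Idl\<^bsub>mpoly_ring\<^esub> F"
  proof (rule mpoly.span_minimal)
    show "?M \<subseteq> Idl\<^bsub>mpoly_ring\<^esub> F" using Idl_superset[of F] ideal_mult(1)[OF I] by auto
    show "mpoly.subspace (Idl\<^bsub>mpoly_ring\<^esub> F)"
      using I ideal_mult(1)[OF I] by (intro mpoly.subspaceI) (simp_all add: ideal_type_iff)
  qed
qed

definition component :: "int ^ 's::finite \<Rightarrow> int \<Rightarrow> ('k::field, 's) mpoly \<Rightarrow> ('k, 's) mpoly" where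
  "component \<omega> d f = (\<Sum>a\<in>{a \<in> Poly_Mapping.keys f. wdeg \<omega> a = d}. Poly_Mapping.single a (Poly_Mapping.lookup f a))"

lemma lookup_component:
  "Poly_Mapping.lookup (component \<omega> d f) a = (if wdeg \<omega> a = d then Poly_Mapping.lookup f a else 0)"
  by (auto simp: component_def lookup_sum lookup_single when_def in_keys_iff)

lemma component_0: "component \<omega> d 0 = 0"
  by (rule poly_mapping_eqI) (simp add: lookup_component)

lemma component_add: "component \<omega> d (f + g) = component \<omega> d f + component \<omega> d g"
  by (rule poly_mapping_eqI) (simp add: lookup_component lookup_add)

lemma component_const_mult: "component \<omega> d (const c * f) = const c * component \<omega> d f"
  by (rule poly_mapping_eqI) (simp add: lookup_component lookup_const_mult)

lemma component_monomial_mult_binom: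
  assumes "homogeneous_lattice \<omega> \<L>" and "a \<in> \<L>"
  shows "component \<omega> d (monomial e * binom a) =
    (if wdeg \<omega> e + wdeg \<omega> (pos_part a) = d then monomial e * binom a else 0)"
proof -
  have eq: "monomial e * binom a = monomial (e + pos_part a) - monomial (e + neg_part a)"
    by (simp add: binom_def monomial_add algebra_simps)
  show ?thesis
    unfolding eq
    by (intro poly_mapping_eqI)
       (auto simp: lookup_component lookup_minus monomial_def lookup_single when_def wdeg_add
         wdeg_pos_neg_part[OF assms])
qed

text \<open>\<open>D i\<close> is the degree of the homogeneous element \<open>\<phi> i\<close>: the
  linear map \<open>component\<close> keeps the spanning elements of degree \<open>d\<close> and
  kills the others.\<close>

lemma component_in_span:
  assumes "f \<in> mpoly.span (\<phi> ` I)"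
    and hom: "\<And>i. i \<in> I \<Longrightarrow> component \<omega> d (\<phi> i) = (if D i = d then \<phi> i else 0)"
  shows "component \<omega> d f \<in> mpoly.span (\<phi> ` {i \<in> I. D i = d})"
  using assms(1)
proof (induction rule: mpoly.span_induct_alt)
  case base
  then show ?case by (simp add: component_0 mpoly.span_zero)
next
  case (step c x y)
  then obtain i where i: "i \<in> I" "x = \<phi> i" by auto
  have "component \<omega> d x \<in> mpoly.span (\<phi> ` {i \<in> I. D i = d})"
    using i hom[OF i(1)] by (auto intro: mpoly.span_zero mpoly.span_base)
  then show ?case
    using step by (simp add: component_add component_const_mult mpoly.span_add mpoly.span_scale)
qed

text \<open>\<open>gen\<close> says that the binomials of \<open>B\<close> span all lattice
  binomials modulo multiples by nonconstant monomials. Take the component of such a representation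
  in the degree of \<open>binom a\<close>: besides binomials of \<open>B\<close> it only has terms
  \<open>t^e binom b\<close> with \<open>e \<noteq> 0\<close>. As the weights are positive,
  \<open>binom b\<close> has smaller degree and is covered by induction.\<close>

lemma graded_nakayama:
  fixes \<omega> :: "int ^ 's::finite" and \<L> :: "(int ^ 's) set"
  assumes omega: "\<And>i. \<omega> $ i > 0" and homog: "homogeneous_lattice \<omega> \<L>" and B: "B \<subseteq> \<L>"
    and gen: "(binom ` \<L> :: ('k::field, 's) mpoly set) \<subseteq> mpoly.span (binom ` B \<union> {monomial e * binom a | e a. e \<noteq> 0 \<and> a \<in> \<L>})"
    and a: "a \<in> \<L>"
  shows "(binom a :: ('k, 's) mpoly) \<in> Idl\<^bsub>mpoly_ring\<^esub> (binom ` B)"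
  using a
proof (induction "nat (wdeg \<omega> (pos_part a))" arbitrary: a rule: less_induct)
  case less
  let ?J = "Idl\<^bsub>mpoly_ring\<^esub> (binom ` B :: ('k, 's) mpoly set)"
  have J: "ideal ?J mpoly_ring" by (rule ideal_Idl)
  define \<phi> :: "(nat ^ 's) \<times> (int ^ 's) \<Rightarrow> ('k, 's) mpoly" where "\<phi> = (\<lambda>(e, b). monomial e * binom b)"
  \<comment> \<open>All spanning elements take the form \<open>t^e binom b\<close>: either
    \<open>e = 0\<close> and \<open>b\<close> is in \<open>B\<close>, or \<open>e \<noteq> 0\<close>
    and \<open>b\<close> is any lattice vector.\<close>
  define I :: "((nat ^ 's) \<times> (int ^ 's)) set" where "I = {0} \<times> B \<union> {e. e \<noteq> 0} \<times> \<L>"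
  define D :: "(nat ^ 's) \<times> (int ^ 's) \<Rightarrow> int" where "D = (\<lambda>(e, b). wdeg \<omega> e + wdeg \<omega> (pos_part b))"
  define d where "d = wdeg \<omega> (pos_part a)"
  have "\<phi> ` I = binom ` B \<union> {monomial e * binom a | e a. e \<noteq> 0 \<and> a \<in> \<L>}"
    by (auto simp: \<phi>_def I_def image_Un monomial_0 image_iff)
  then have "binom a \<in> mpoly.span (\<phi> ` I)" using gen less.prems by auto
  moreover have "component \<omega> d (\<phi> i) = (if D i = d then \<phi> i else 0)" if "i \<in> I" for i
  proof -
    obtain e b where i: "i = (e, b)" by (cases i)
    have "b \<in> \<L>" using that B by (auto simp: i I_def)
    then show ?thesis by (simp add: i \<phi>_def D_def component_monomial_mult_binom[OF homog])
  qed
  ultimately have "component \<omega> d (binom a) \<in> mpoly.span (\<phi> ` {i \<in> I. D i = d})"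
    by (rule component_in_span)
  moreover have "component \<omega> d (binom a) = (binom a :: ('k, 's) mpoly)"
    using component_monomial_mult_binom[OF homog less.prems, of d 0, where 'b = 'k]
    by (simp add: monomial_0 d_def wdeg_def)
  moreover have "mpoly.span (\<phi> ` {i \<in> I. D i = d}) \<subseteq> ?J"
  proof (rule mpoly.span_minimal)
    show "mpoly.subspace ?J"
      using J ideal_mult(1)[OF J] by (intro mpoly.subspaceI) (simp_all add: ideal_type_iff)
    have "\<phi> (e, b) \<in> ?J" if "(e, b) \<in> I" "D (e, b) = d" for e b
    proof (cases "e = 0")
      case True
      then have "b \<in> B" using that(1) by (simp add: I_def)
      then show ?thesis using Idl_superset[of "binom ` B"] True by (auto simp: \<phi>_def monomial_0)
    next
      case False
      then have b: "b \<in> \<L>" using that(1) by (simp add: I_def)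
      have "wdeg \<omega> e > 0" using False by (intro wdeg_pos omega)
      moreover have "wdeg \<omega> (pos_part b) \<ge> 0" by (rule wdeg_nonneg[OF omega])
      ultimately have "nat (wdeg \<omega> (pos_part b)) < nat (wdeg \<omega> (pos_part a))"
        using that(2) by (simp add: D_def d_def)
      then have "binom b \<in> ?J" using less.hyps b by blast
      then show ?thesis using ideal_mult(1)[OF J] by (simp add: \<phi>_def)
    qed
    then show "\<phi> ` {i \<in> I. D i = d} \<subseteq> ?J" by auto
  qed
  ultimately show ?case by auto
qed

text \<open>\<open>W\<close> is the product of the lattice ideal with the ideal of the variables.
  Modulo \<open>W\<close> only constant multipliers survive, so \<open>G\<close> spans the ideal as
  a vector space; the exchange yields no more than \<open>card G\<close> binomials that span it
  modulo \<open>W\<close>, and by \<open>graded_nakayama\<close> they generate it.\<close>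

lemma binomial_generators:
  fixes \<omega> :: "int ^ 's::finite" and \<L> :: "(int ^ 's) set"
  assumes omega: "\<And>i. \<omega> $ i > 0" and homog: "homogeneous_lattice \<omega> \<L>"
    and G: "finite G" "lattice_ideal \<L> = Idl\<^bsub>mpoly_ring\<^esub> (G :: ('k::field, 's) mpoly set)"
  shows "\<exists>B\<subseteq>\<L>. finite B \<and> card B \<le> card G \<and>
    (lattice_ideal \<L> :: ('k, 's) mpoly set) = Idl\<^bsub>mpoly_ring\<^esub> (binom ` B)"
proof -
  let ?L = "lattice_ideal \<L> :: ('k, 's) mpoly set"
  let ?M = "{monomial e * binom a | e a. e \<noteq> 0 \<and> a \<in> \<L>} :: ('k, 's) mpoly set"
  define W where "W = mpoly.span ?M"
  have L: "?L = mpoly.span {monomial e * f | e f. f \<in> binom ` \<L>}"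
    unfolding lattice_ideal_binom by (rule Idl_eq_span)
  have mW: "monomial e * f \<in> W" if "f \<in> ?L" "e \<noteq> 0" for e f
    using that(1) unfolding L
  proof (induction rule: mpoly.span_induct_alt)
    case base
    then show ?case by (simp add: W_def mpoly.span_zero)
  next
    case (step c x y)
    then obtain e' a where x: "x = monomial e' * binom a" "a \<in> \<L>" by auto
    have "e + e' \<noteq> 0" using that(2) by (auto simp: vec_eq_iff)
    then have "monomial (e + e') * binom a \<in> ?M" using x(2) by auto
    then have "const c * (monomial (e + e') * binom a) \<in> W"
      unfolding W_def by (intro mpoly.span_scale mpoly.span_base)
    moreover have "monomial e * (const c * x + y) = const c * (monomial (e + e') * binom a) + monomial e * y"
      by (simp add: x monomial_add algebra_simps)
    ultimately show ?case using step by (simp add: W_def mpoly.span_add)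
  qed
  have "{monomial e * f | e f. f \<in> G} \<subseteq> mpoly.span (G \<union> W)"
  proof
    fix x assume "x \<in> {monomial e * f | e f. f \<in> G}"
    then obtain e f where x: "x = monomial e * f" "f \<in> G" by auto
    then have "f \<in> ?L" unfolding G(2) using Idl_superset[of G] by auto
    then have "x \<in> G \<union> W" using mW[of f e] x by (cases "e = 0") (auto simp: monomial_0)
    then show "x \<in> mpoly.span (G \<union> W)" by (rule mpoly.span_base)
  qed
  then have "?L \<subseteq> mpoly.span (G \<union> W)"
    unfolding G(2) Idl_eq_span by (intro mpoly.span_minimal) auto
  moreover have "binom ` \<L> \<subseteq> ?L" unfolding lattice_ideal_binom by (rule Idl_superset)
  ultimately have "binom ` \<L> \<subseteq> mpoly.span (G \<union> W)" by (rule order_trans[rotated])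
  from mpoly.exchange_modulo[OF G(1) mpoly.subspace_span[of ?M, folded W_def] this]
  obtain B' where B': "B' \<subseteq> binom ` \<L>" "finite B'" "card B' \<le> card G"
    "binom ` \<L> \<subseteq> mpoly.span (B' \<union> W)"
    by (elim exE conjE)
  \<comment> \<open>Choosing one lattice vector per binomial makes \<open>binom\<close> injective on
    \<open>B\<close>, so \<open>B\<close> is no larger than \<open>B'\<close>.\<close>
  then obtain B where B: "B \<subseteq> \<L>" "inj_on (binom :: _ \<Rightarrow> ('k, 's) mpoly) B" "B' = binom ` B"
    by (metis subset_image_inj)
  have "mpoly.span (B' \<union> W) \<subseteq> mpoly.span (binom ` B \<union> ?M)"
    unfolding B(3) W_def
    by (intro mpoly.span_minimal Un_least mpoly.span_mono) (auto intro: mpoly.span_base)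
  then have "binom ` \<L> \<subseteq> mpoly.span (binom ` B \<union> ?M)" using B'(4) by auto
  then have "binom ` \<L> \<subseteq> Idl\<^bsub>mpoly_ring\<^esub> (binom ` B :: ('k, 's) mpoly set)"
    using graded_nakayama[OF omega homog B(1)] by auto
  then have "?L \<subseteq> Idl\<^bsub>mpoly_ring\<^esub> (binom ` B)"
    unfolding lattice_ideal_binom by (rule Idl_subsetI[OF ideal_Idl])
  moreover have "Idl\<^bsub>mpoly_ring\<^esub> (binom ` B) \<subseteq> ?L"
    unfolding lattice_ideal_binom
    using B(1) Idl_superset[of "binom ` \<L>"] by (intro Idl_subsetI ideal_Idl) auto
  moreover have "finite B" "card B \<le> card G"
    using B' B(2,3) by (auto simp: finite_image_iff card_image)
  ultimately show ?thesis using B(1) by auto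
qed

section \<open>Lattices and their ideals\<close>

lemma group_int_vec: "group int_vec_group"
  unfolding int_vec_group_def
  by (rule groupI) (auto simp: add.assoc intro: exI[of _ "- x" for x])

lemma inv_int_vec: "inv\<^bsub>int_vec_group\<^esub> x = - x"
  by (rule group.inv_equality[OF group_int_vec]) (simp_all add: int_vec_group_def)

lemma subgroup_int_vec_iff:
  "subgroup H int_vec_group \<longleftrightarrow> 0 \<in> H \<and> (\<forall>x\<in>H. \<forall>y\<in>H. x + y \<in> H) \<and> (\<forall>x\<in>H. - x \<in> H)"
proof -
  have "subgroup H int_vec_group \<longleftrightarrow> H \<subseteq> carrier int_vec_group \<and> \<one>\<^bsub>int_vec_group\<^esub> \<in> H \<and>
    (\<forall>x\<in>H. \<forall>y\<in>H. x \<otimes>\<^bsub>int_vec_group\<^esub> y \<in> H) \<and> (\<forall>x\<in>H. inv\<^bsub>int_vec_group\<^esub> x \<in> H)"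
    by (auto simp: subgroup_def)
  then show ?thesis unfolding inv_int_vec by (simp add: int_vec_group_def)
qed

lemma subgroup_generate_int_vec: "subgroup (generate int_vec_group S) int_vec_group"
  by (rule group.generate_is_subgroup[OF group_int_vec]) (simp add: int_vec_group_def)

lemma generate_int_vec_subset:
  assumes "subgroup H int_vec_group" "S \<subseteq> H"
  shows "generate int_vec_group S \<subseteq> H"
  using group.generate_subgroup_incl[OF group_int_vec assms(2,1)] .

text \<open>A subgroup contains the negative of each of its vectors. This absorbs the sign that
  \<open>binomial_hat\<close> leaves open in characteristic 2.\<close>

lemma generate_sign:
  assumes "\<And>j. j \<in> J \<Longrightarrow> f j = g j \<or> f j = - g j"
  shows "generate int_vec_group (f ` J) = generate int_vec_group (g ` J)"
proof -
  have "generate int_vec_group (f ` J) \<subseteq> generate int_vec_group (g ` J)"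
    if fg: "\<And>j. j \<in> J \<Longrightarrow> f j = g j \<or> f j = - g j" for f g :: "'a \<Rightarrow> int ^ 'b"
  proof (rule generate_int_vec_subset[OF subgroup_generate_int_vec])
    show "f ` J \<subseteq> generate int_vec_group (g ` J)"
    proof
      fix x assume "x \<in> f ` J"
      then obtain j where j: "j \<in> J" "x = f j" by auto
      have "g j \<in> generate int_vec_group (g ` J)" using j(1) by (intro generate.incl imageI)
      moreover from this have "- g j \<in> generate int_vec_group (g ` J)"
        using subgroup_generate_int_vec[of "g ` J"] unfolding subgroup_int_vec_iff by simp
      ultimately show "x \<in> generate int_vec_group (g ` J)" using fg[OF j(1)] j(2) by auto
    qed
  qed
  from this[of f g] this[of g f] assms show ?thesis by (metis equation_minus_iff subset_antisym)
qed

lemma int_vec_pos_neg_part: "int_vec (pos_part a) - int_vec (neg_part a) = a"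
  using pos_neg_decomposition[of a "pos_part a" "neg_part a"] by simp

lemma int_vec_add: "int_vec (x + y) = int_vec x + int_vec y"
  by (simp add: int_vec_def vec_eq_iff)

lemma int_vec_inj: "int_vec x = int_vec y \<Longrightarrow> x = y"
  by (simp add: int_vec_def vec_eq_iff)

lemma binomial_hat_binom: "binomial_hat (binom a :: ('k::field, 's::finite) mpoly) = a \<or>
    binomial_hat (binom a :: ('k, 's) mpoly) = - a"
proof -
  have "int_vec (neg_part a) - int_vec (pos_part a) = - a"
    by (metis int_vec_pos_neg_part minus_diff_eq)
  then show ?thesis
    using binomial_hat_eq[of "pos_part a" "neg_part a", where 'k = 'k]
    unfolding binom_def int_vec_pos_neg_part by auto
qed

text \<open>The functional \<open>\<psi>\<close> adds up the coefficients at exponents in the coset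
  of \<open>pos_part v\<close> modulo the subgroup \<open>H\<close> generated by \<open>B\<close>.
  For \<open>a\<close> in \<open>B\<close> both exponents of \<open>t^e binom a\<close> lie in the
  same coset, so \<open>\<psi>\<close> vanishes on the ideal. Its vanishing on
  \<open>binom v\<close> puts \<open>neg_part v\<close> into the coset, hence \<open>v\<close> into
  \<open>H\<close>.\<close>

lemma lattice_generated:
  fixes \<L> :: "(int ^ 's::finite) set"
  assumes "binom ` \<L> \<subseteq> Idl\<^bsub>mpoly_ring\<^esub> (binom ` B :: ('k::field, 's) mpoly set)"
  shows "\<L> \<subseteq> generate int_vec_group B"
proof
  fix v assume v: "v \<in> \<L>"
  define H where "H = generate int_vec_group B"
  have H: "0 \<in> H" "\<And>x y. x \<in> H \<Longrightarrow> y \<in> H \<Longrightarrow> x + y \<in> H" "\<And>x. x \<in> H \<Longrightarrow> - x \<in> H"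
    using subgroup_generate_int_vec[of B] unfolding subgroup_int_vec_iff H_def by auto
  define C where "C = {e. int_vec e - int_vec (pos_part v) \<in> H}"
  define \<psi> :: "('k, 's) mpoly \<Rightarrow> 'k" where "\<psi> f = (\<Sum>e\<in>Poly_Mapping.keys f. if e \<in> C then Poly_Mapping.lookup f e else 0)" for f
  have super: "\<psi> f = (\<Sum>e\<in>A. if e \<in> C then Poly_Mapping.lookup f e else 0)"
    if "finite A" "Poly_Mapping.keys f \<subseteq> A" for f A
    unfolding \<psi>_def by (rule sum.mono_neutral_left) (use that in \<open>auto simp: in_keys_iff\<close>)
  have add: "\<psi> (f + g) = \<psi> f + \<psi> g" for f g
  proof -
    let ?A = "Poly_Mapping.keys f \<union> Poly_Mapping.keys g"
    have "Poly_Mapping.keys (f + g) \<subseteq> ?A" by (rule Poly_Mapping.keys_add)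
    then show ?thesis
      by (simp add: super[of ?A] lookup_add sum.distrib[symmetric] if_distrib cong: if_cong sum.cong)
  qed
  have scale: "\<psi> (const c * f) = c * \<psi> f" for c f
  proof -
    have "Poly_Mapping.keys (const c * f) \<subseteq> Poly_Mapping.keys f"
      by (auto simp: in_keys_iff lookup_const_mult)
    then show ?thesis
      by (auto simp: super[of "Poly_Mapping.keys f"] lookup_const_mult sum_distrib_left intro!: sum.cong)
  qed
  have diff: "\<psi> (f - g) = \<psi> f - \<psi> g" for f g using add[of "f - g" g] by simp
  have mono: "\<psi> (monomial e) = (if e \<in> C then 1 else 0)" for e
    by (simp add: \<psi>_def monomial_def)
  have binom: "\<psi> (monomial e * binom a) = 0" if "a \<in> B" for e a
  proof -
    have a: "a \<in> H" unfolding H_def by (rule generate.incl[OF that])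
    have eq: "int_vec (e + pos_part a) - int_vec (pos_part v) =
      a + (int_vec (e + neg_part a) - int_vec (pos_part v))"
      using int_vec_pos_neg_part[of a] by (simp add: int_vec_add algebra_simps)
    have "e + pos_part a \<in> C \<longleftrightarrow> e + neg_part a \<in> C"
    proof
      assume "e + pos_part a \<in> C"
      then have "- a + (int_vec (e + pos_part a) - int_vec (pos_part v)) \<in> H"
        by (intro H(2) H(3)[OF a]) (simp add: C_def)
      then show "e + neg_part a \<in> C" unfolding eq by (simp add: C_def)
    next
      assume "e + neg_part a \<in> C"
      then have "a + (int_vec (e + neg_part a) - int_vec (pos_part v)) \<in> H"
        by (intro H(2)[OF a]) (simp add: C_def)
      then show "e + pos_part a \<in> C" unfolding eq[symmetric] by (simp add: C_def)
    qed
    moreover have "monomial e * binom a = monomial (e + pos_part a) - (monomial (e + neg_part a) :: ('k, 's) mpoly)"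
      by (simp add: binom_def monomial_add algebra_simps)
    ultimately show ?thesis by (simp add: diff mono)
  qed
  have "mpoly.span {monomial e * f | e f. f \<in> binom ` B} \<subseteq> {f. \<psi> f = 0}"
  proof (rule mpoly.span_minimal)
    show "{monomial e * f | e f. f \<in> binom ` B} \<subseteq> {f. \<psi> f = 0}" using binom by auto
    show "mpoly.subspace {f. \<psi> f = 0}"
      by (rule mpoly.subspaceI) (simp_all add: add scale, simp add: \<psi>_def)
  qed
  then have "\<psi> (binom v) = 0" using assms v unfolding Idl_eq_span by auto
  moreover have "pos_part v \<in> C" using H(1) by (simp add: C_def)
  ultimately have "neg_part v \<in> C"
    unfolding binom_def diff mono by (auto split: if_splits)
  then have "- (int_vec (neg_part v) - int_vec (pos_part v)) \<in> H"
    by (intro H(3)) (simp add: C_def)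
  then show "v \<in> generate int_vec_group B" using int_vec_pos_neg_part[of v] by (simp add: H_def)
qed

section \<open>From congruences to ideal membership\<close>

lemma moncong_ideal:
  assumes "moncong p q D x y" and I: "ideal I mpoly_ring"
    and "\<And>j. j \<in> D \<Longrightarrow> monomial (p j) - monomial (q j) \<in> I"
  shows "monomial x - (monomial y :: ('k::field, 's::finite) mpoly) \<in> I"
  using assms(1)
proof (induction rule: moncong.induct)
  case (gen j c)
  have "(monomial (p j) - monomial (q j)) * monomial c \<in> I"
    by (rule ideal_mult(2)[OF I assms(3)[OF gen]])
  then show ?case by (simp add: monomial_add algebra_simps)
next
  case (refl x)
  then show ?case using I by (simp add: ideal_type_iff)
next
  case (sym x y)
  from ideal_uminus[OF I sym.IH] show ?case by simp
next
  case (trans x y z)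
  have "(monomial x - monomial y) + (monomial y - monomial z) \<in> I"
    using trans.IH by (rule ideal_add[OF I])
  then show ?case by simp
qed

text \<open>The differences \<open>v\<close> for which this holds for all \<open>x\<close> and
  \<open>y\<close> form a subgroup that contains the generators. The common summand \<open>z\<close>
  can be removed once the congruence is cancellative.\<close>

lemma generate_moncong:
  fixes a :: "'j \<Rightarrow> int ^ 's::finite"
  assumes "v \<in> generate int_vec_group (a ` D)" and "int_vec x = int_vec y + v"
  shows "\<exists>z. moncong (\<lambda>j. pos_part (a j)) (\<lambda>j. neg_part (a j)) D (x + z) (y + z)"
proof -
  let ?R = "moncong (\<lambda>j. pos_part (a j)) (\<lambda>j. neg_part (a j)) D"
  define H where "H = {v. \<forall>x y. int_vec x = int_vec y + v \<longrightarrow> (\<exists>z. ?R (x + z) (y + z))}"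
  have HD: "\<exists>z. ?R (x + z) (y + z)" if "u \<in> H" "int_vec x = int_vec y + u" for u x y
    using that(1)[unfolded H_def mem_Collect_eq, rule_format, OF that(2)] .
  have "subgroup H int_vec_group"
    unfolding subgroup_int_vec_iff
  proof (intro conjI ballI)
    show "0 \<in> H" unfolding H_def using int_vec_inj moncong.refl by fastforce
    show "- u \<in> H" if "u \<in> H" for u
      unfolding H_def
    proof (intro CollectI allI impI)
      fix x y assume "int_vec x = int_vec y + - u"
      then have "int_vec y = int_vec x + u" by simp
      from HD[OF that this] obtain z where "?R (y + z) (x + z)" by (elim exE)
      then have "?R (x + z) (y + z)" by (rule moncong.sym)
      then show "\<exists>z. ?R (x + z) (y + z)" by (rule exI)
    qed
    show "u + v \<in> H" if "u \<in> H" "v \<in> H" for u v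
      unfolding H_def
    proof (intro CollectI allI impI)
      fix x y assume xy: "int_vec x = int_vec y + (u + v)"
      have "int_vec (pos_part u) = int_vec (neg_part u) + u" using int_vec_pos_neg_part[of u] by (simp add: algebra_simps)
      from HD[OF that(1) this] obtain z where z: "?R (pos_part u + z) (neg_part u + z)" by (elim exE)
      \<comment> \<open>The intermediate vector \<open>y + u\<close> may have negative entries.
        Adding \<open>neg_part u\<close> to \<open>x\<close> and \<open>pos_part u\<close> to
        \<open>y\<close> keeps all entries natural.\<close>
      have "int_vec (x + neg_part u) = int_vec (y + pos_part u) + v"
        using int_vec_pos_neg_part[of u] xy by (simp add: int_vec_add algebra_simps)
      from HD[OF that(2) this] obtain z' where z': "?R (x + neg_part u + z') (y + pos_part u + z')"
        by (elim exE)
      have "?R (x + neg_part u + z' + z) (y + pos_part u + z' + z)"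
        by (rule moncong_add_right[OF z'])
      moreover have "?R (pos_part u + z + (y + z')) (neg_part u + z + (y + z'))"
        by (rule moncong_add_right[OF z])
      then have "?R (y + pos_part u + z' + z) (y + (neg_part u + z' + z))" by (simp add: add_ac)
      ultimately have "?R (x + neg_part u + z' + z) (y + (neg_part u + z' + z))" by (rule moncong.trans)
      then have "?R (x + (neg_part u + z' + z)) (y + (neg_part u + z' + z))" by (simp add: add_ac)
      then show "\<exists>z. ?R (x + z) (y + z)" by (rule exI)
    qed
  qed
  moreover have "a ` D \<subseteq> H"
  proof
    fix v assume "v \<in> a ` D"
    then obtain j where j: "j \<in> D" "v = a j" by auto
    show "v \<in> H"
      unfolding H_def
    proof (intro CollectI allI impI)
      fix x y assume "int_vec x = int_vec y + v"
      then have "int_vec (x + neg_part v) = int_vec (y + pos_part v)"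
        using int_vec_pos_neg_part[of v] by (simp add: int_vec_add algebra_simps)
      then have eq: "x + neg_part v = y + pos_part v" by (rule int_vec_inj)
      have "?R (pos_part v + y) (neg_part v + y)" unfolding j(2) by (rule moncong.gen[OF j(1)])
      then have "?R (x + neg_part v) (y + neg_part v)" unfolding eq by (simp add: add_ac)
      then show "\<exists>z. ?R (x + z) (y + z)" by (rule exI)
    qed
  qed
  ultimately have "generate int_vec_group (a ` D) \<subseteq> H" by (rule generate_int_vec_subset)
  then have "v \<in> H" using assms(1) by auto
  from HD[OF this assms(2)] show ?thesis .
qed

text \<open>The two parts of \<open>v\<close> are congruent after adding a common summand; gluing
  allows its cancellation, and congruent exponents give monomials that agree modulo the
  ideal.\<close>

lemma glued_binom_in_Idl:
  fixes a :: "'j \<Rightarrow> int ^ 's::finite"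
  assumes "glued (\<lambda>j. supp (pos_part (a j))) (\<lambda>j. supp (neg_part (a j))) UNIV D"
    and "v \<in> generate int_vec_group (a ` D)"
  shows "binom v \<in> Idl\<^bsub>mpoly_ring\<^esub> (binom ` a ` D :: ('k::field, 's) mpoly set)"
proof -
  let ?R = "moncong (\<lambda>j. pos_part (a j)) (\<lambda>j. neg_part (a j)) D"
  have "int_vec (pos_part v) = int_vec (neg_part v) + v"
    using int_vec_pos_neg_part[of v] by (simp add: algebra_simps)
  from generate_moncong[OF assms(2) this]
  obtain z where "?R (pos_part v + z) (neg_part v + z)" by blast
  then have R: "?R (pos_part v) (neg_part v)"
    using glued_cancellative[OF assms(1)] unfolding cancellative_def by blast
  show ?thesis
    unfolding binom_def[of v]
  proof (rule moncong_ideal[OF R ideal_Idl])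
    fix j assume "j \<in> D"
    then have "binom (a j) \<in> (binom ` a ` D :: ('k, 's) mpoly set)" by (intro imageI)
    from subsetD[OF Idl_superset this]
    show "monomial (pos_part (a j)) - monomial (neg_part (a j)) \<in>
      Idl\<^bsub>mpoly_ring\<^esub> (binom ` a ` D :: ('k, 's) mpoly set)"
      unfolding binom_def[of "a j"] .
  qed
qed

section \<open>Multiples of unit vectors modulo the lattice\<close>

lemma subgroup_int_vec_sum:
  assumes "subgroup H int_vec_group" and "\<And>k. k \<in> A \<Longrightarrow> f k \<in> H"
  shows "sum f A \<in> H"
  using assms(2) assms(1)[unfolded subgroup_int_vec_iff]
  by (induction A rule: infinite_finite_induct) auto

text \<open>Products of vectors are componentwise and \<open>of_int c\<close> is a constant vector,
  so \<open>of_int c * x\<close> is the integer multiple of \<open>x\<close> by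
  \<open>c\<close>.\<close>

lemma subgroup_int_vec_scale:
  assumes "subgroup H int_vec_group" and "x \<in> H"
  shows "of_int c * x \<in> H"
proof -
  have *: "of_nat n * x \<in> H" for n
    using subgroup_int_vec_sum[OF assms(1), of "{..<n}" "\<lambda>_. x"] assms(2) by simp
  show ?thesis
  proof (cases c rule: int_cases2)
    case (nonpos n)
    have "- (of_nat n * x) \<in> H" using *[of n] assms(1) unfolding subgroup_int_vec_iff by simp
    then show ?thesis by (simp add: nonpos)
  qed (use * in simp)
qed

lemma of_int_vec_nth: "(of_int c :: int ^ 's::finite) $ k = c"
  by (cases c rule: int_cases2) (simp_all add: of_nat_index)

lemma of_int_mult_axis: "of_int c * axis k d = (axis k (c * d) :: int ^ 's::finite)"
  by (simp add: vec_eq_iff axis_def of_int_vec_nth)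

text \<open>Modulo \<open>H\<close> each unit vector of \<open>U\<close> has a positive multiple
  that is a positive multiple of the \<open>i\<close>-th one. Bringing these to the common factor
  \<open>M\<close> and adding them with the entries of \<open>x\<close> as multiplicities expresses
  \<open>M x\<close>; the result is a positive multiple since \<open>x\<close> is nonzero with
  nonnegative entries.\<close>

lemma axis_combination:
  fixes x :: "nat ^ 's::finite"
  assumes H: "subgroup H int_vec_group" and x: "supp x \<subseteq> U" "x \<noteq> 0"
    and axes: "\<And>k. k \<in> U \<Longrightarrow> \<exists>m n. m > 0 \<and> n > 0 \<and> axis k m - axis i n \<in> H"
  shows "\<exists>m n. m > 0 \<and> n > 0 \<and> of_int m * int_vec x - axis i n \<in> H"
proof -
  have "\<forall>k. \<exists>m n. k \<in> U \<longrightarrow> m > 0 \<and> n > 0 \<and> axis k m - axis i n \<in> H" using axes by metis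
  then obtain m n where mn: "\<And>k. k \<in> U \<Longrightarrow> m k > 0 \<and> n k > 0 \<and> axis k (m k) - axis i (n k) \<in> H"
    by metis
  define M where "M = (\<Prod>k\<in>U. m k)"
  have M: "M > 0" unfolding M_def by (rule prod_pos) (use mn in auto)
  define N where "N k = (M div m k) * n k" for k
  have dvd: "M div m k * m k = M" if "k \<in> U" for k
    unfolding M_def by (rule dvd_div_mult_self) (use that in auto)
  have pos: "N k > 0" if "k \<in> U" for k
  proof -
    have "0 < M div m k" using dvd[OF that] M mn[OF that] by (metis zero_less_mult_pos2)
    then show ?thesis using mn[OF that] by (simp add: N_def)
  qed
  have N: "axis k M - axis i (N k) \<in> H" if "k \<in> U" for k
  proof -
    have "of_int (M div m k) * (axis k (m k) - axis i (n k)) \<in> H"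
      using mn[OF that] by (intro subgroup_int_vec_scale H) auto
    then show ?thesis
      unfolding right_diff_distrib of_int_mult_axis dvd[OF that] N_def .
  qed
  have "(\<Sum>k\<in>U. of_int (int (x $ k)) * (axis k M - axis i (N k))) \<in> H"
    using N by (intro subgroup_int_vec_sum[OF H] subgroup_int_vec_scale[OF H])
  also have "(\<Sum>k\<in>U. of_int (int (x $ k)) * (axis k M - axis i (N k))) =
    (\<Sum>k\<in>U. axis k (int (x $ k) * M)) - (\<Sum>k\<in>U. axis i (int (x $ k) * N k))"
    unfolding right_diff_distrib of_int_mult_axis sum_subtractf ..
  also have "(\<Sum>k\<in>U. axis k (int (x $ k) * M)) = of_int M * int_vec x"
  proof -
    have "(\<Sum>k\<in>U. (if l = k then int (x $ k) * M else 0)) = M * int (x $ l)" for l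
      using x(1) by (auto simp: supp_def mult.commute)
    then show ?thesis by (simp add: vec_eq_iff axis_def int_vec_def of_int_vec_nth eq_commute cong: if_cong)
  qed
  also have "(\<Sum>k\<in>U. axis i (int (x $ k) * N k)) = axis i (\<Sum>k\<in>U. int (x $ k) * N k)"
    by (simp add: vec_eq_iff axis_def)
  finally have "of_int M * int_vec x - axis i (\<Sum>k\<in>U. int (x $ k) * N k) \<in> H" .
  moreover have "0 < (\<Sum>k\<in>U. int (x $ k) * N k)"
  proof -
    obtain k where "x $ k \<noteq> 0" using x(2) by (auto simp: vec_eq_iff)
    then have k: "k \<in> U" "x $ k > 0" using x(1) by (auto simp: supp_def)
    then have "0 < int (x $ k) * N k" using pos[OF k(1)] by simp
    also have "\<dots> \<le> (\<Sum>k\<in>U. int (x $ k) * N k)"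
      using k(1) pos by (intro member_le_sum) (auto simp: less_imp_le)
    finally show ?thesis .
  qed
  ultimately show ?thesis using M by metis
qed

text \<open>At a node of the tree each side of the column \<open>j\<close> has, modulo
  \<open>H\<close>, a positive multiple that is a positive multiple of any unit vector of its
  subtree. As \<open>a j\<close> identifies the two sides, the unit vectors across the node become
  proportional too. For the lattice ideal this provides the binomials
  \<open>t_k^m - t_i^n\<close>.\<close>

lemma glued_axis_difference:
  fixes a :: "'j \<Rightarrow> int ^ 's::finite"
  assumes "glued (\<lambda>j. supp (pos_part (a j))) (\<lambda>j. supp (neg_part (a j))) U D"
    and H: "subgroup H int_vec_group" and "a ` D \<subseteq> H" and "i \<in> U" "k \<in> U"
  shows "\<exists>m n. m > 0 \<and> n > 0 \<and> axis k m - axis i n \<in> H"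
  using assms(1,3-)
proof (induction arbitrary: i k rule: glued.induct)
  case (single v)
  have "axis v (1::int) - axis v 1 \<in> H" using H unfolding subgroup_int_vec_iff by simp
  then show ?case using single by (metis singletonD zero_less_one)
next
  case (glue U D V E j)
  have cross: "\<exists>m n. m > 0 \<and> n > 0 \<and> axis k m - axis i n \<in> H" if "i \<in> U" "k \<in> V" for i k
  proof -
    let ?x = "pos_part (a j)" and ?y = "neg_part (a j)"
    have ne: "?x \<noteq> 0" "?y \<noteq> 0" using glue.hyps(4,5) by (auto simp: supp_def)
    have "\<exists>m n. m > 0 \<and> n > 0 \<and> of_int m * int_vec ?x - axis i n \<in> H"
      using glue.prems(1) that(1)
      by (intro axis_combination[OF H glue.hyps(6) ne(1)] glue.IH(1)) auto
    then obtain m n where mn: "m > 0" "n > 0" "of_int m * int_vec ?x - axis i n \<in> H" by metis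
    have "\<exists>m n. m > 0 \<and> n > 0 \<and> of_int m * int_vec ?y - axis k n \<in> H"
      using glue.prems(1) that(2)
      by (intro axis_combination[OF H glue.hyps(7) ne(2)] glue.IH(2)) auto
    then obtain m' n' where mn': "m' > 0" "n' > 0" "of_int m' * int_vec ?y - axis k n' \<in> H" by metis
    have "a j \<in> H" using glue.prems(1) by auto
    then have "of_int (m * m') * (int_vec ?x - int_vec ?y) \<in> H"
      by (intro subgroup_int_vec_scale[OF H]) (simp add: int_vec_pos_neg_part)
    then have "- (of_int (m * m') * (int_vec ?x - int_vec ?y)) \<in> H"
      using H unfolding subgroup_int_vec_iff by simp
    moreover have "of_int m' * (of_int m * int_vec ?x - axis i n) \<in> H"
      by (rule subgroup_int_vec_scale[OF H mn(3)])
    moreover have "of_int (- m) * (of_int m' * int_vec ?y - axis k n') \<in> H"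
      by (rule subgroup_int_vec_scale[OF H mn'(3)])
    moreover have "u + v + w \<in> H" if "w \<in> H" "u \<in> H" "v \<in> H" for u v w
      using that H unfolding subgroup_int_vec_iff by simp
    \<comment> \<open>With x - y = \<open>a j\<close> the identity is m' (m x - n e_i) - m (m' y -
      n' e_k) - m m' (x - y) = m n' e_k - m' n e_i.\<close>
    ultimately have "of_int m' * (of_int m * int_vec ?x - axis i n) +
      of_int (- m) * (of_int m' * int_vec ?y - axis k n') +
      - (of_int (m * m') * (int_vec ?x - int_vec ?y)) \<in> H" by iprover
    also have "of_int m' * (of_int m * int_vec ?x - axis i n) +
      of_int (- m) * (of_int m' * int_vec ?y - axis k n') +
      - (of_int (m * m') * (int_vec ?x - int_vec ?y)) =
      of_int m * axis k n' - of_int m' * axis i n"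
      by (simp add: algebra_simps)
    finally have "axis k (m * n') - axis i (m' * n) \<in> H" by (simp only: of_int_mult_axis)
    moreover have "m * n' > 0" "m' * n > 0" using mn mn' by simp_all
    ultimately show ?thesis by metis
  qed
  have neg: "axis i n - axis k m \<in> H" if "axis k m - axis i n \<in> H" for i k and m n :: int
    using H that unfolding subgroup_int_vec_iff by (metis minus_diff_eq)
  have DE: "a ` D \<subseteq> H" "a ` E \<subseteq> H" using glue.prems(1) by (simp_all add: image_Un)
  consider "i \<in> U" "k \<in> U" | "i \<in> V" "k \<in> V" | "i \<in> U" "k \<in> V" | "i \<in> V" "k \<in> U"
    using glue.prems(2,3) by auto
  then show ?case
  proof cases
    case 1
    then show ?thesis by (rule glue.IH(1)[OF DE(1)])
  next
    case 2
    then show ?thesis by (rule glue.IH(2)[OF DE(2)])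
  next
    case 3
    then show ?thesis by (rule cross)
  next
    case 4
    from cross[OF 4(2,1)] neg show ?thesis by metis
  qed
qed

lemma binom_axis_difference:
  assumes "i \<noteq> k" "m > 0" "n > 0"
  shows "binom (axis k m - axis i n) = (indet k ^ nat m - indet i ^ nat n :: ('k::field, 's::finite) mpoly)"
proof -
  have "pos_part (axis k m - axis i n) = axis k (nat m)" "neg_part (axis k m - axis i n) = axis i (nat n)"
    using assms by (auto simp: pos_part_def neg_part_def axis_def vec_eq_iff)
  then show ?thesis by (simp add: binom_def monomial_axis)
qed

lemma homogeneous_binom:
  assumes "homogeneous_lattice \<omega> \<L>" and "a \<in> \<L>"
  shows "homogeneous \<omega> (binom a)"
  unfolding homogeneous_def
proof (intro exI ballI)
  fix e assume "e \<in> Poly_Mapping.keys (binom a)"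
  then have "e = pos_part a \<or> e = neg_part a"
    by (auto simp: binom_def monomial_def in_keys_iff lookup_minus lookup_single when_def split: if_splits)
  then show "(\<Sum>i\<in>UNIV. \<omega> $ i * int (e $ i)) = wdeg \<omega> (pos_part a)"
    using wdeg_pos_neg_part[OF assms] by (auto simp: wdeg_def)
qed

lemma eval_monomial_indicator:
  "eval_mpoly (monomial e) (\<chi> i. if i \<in> T then 1 else 0) = (if supp e \<subseteq> T then 1 else (0 :: 'k::field))"
proof (cases "supp e \<subseteq> T")
  case True
  have "(if i \<in> T then 1 else 0) ^ (e $ i) = (1 :: 'k)" for i
  proof (cases "i \<in> T")
    case False
    then have "e $ i = 0" using True by (auto simp: supp_def)
    then show ?thesis by simp
  qed simp
  then show ?thesis using True by (simp add: eval_mpoly_monomial)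
next
  case False
  then obtain i where "i \<notin> T" "e $ i \<noteq> 0" by (auto simp: supp_def)
  then have "(if i \<in> T then 1 else 0) ^ (e $ i) = (0 :: 'k)" by simp
  then have "\<exists>i. (if i \<in> T then 1 else 0) ^ (e $ i) = (0 :: 'k)" by (rule exI)
  then show ?thesis using False by (simp add: eval_mpoly_monomial)
qed

section \<open>The two implications\<close>

text \<open>The zeros at indicator points show that the supports are glued. The gluing gives that s
  - 1 binomials generate the lattice ideal and that its height is at least s - 1; the monomial curve
  gives the opposite bound.\<close>

lemma complete_intersection_of_binomials:
  fixes \<omega> :: "int ^ 's::finite" and a :: "nat \<Rightarrow> int ^ 's"
  defines "J \<equiv> {..<CARD('s) - 1}"
  assumes omega: "\<And>i. \<omega> $ i > 0" and homog: "homogeneous_lattice \<omega> \<L>"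
    and gen: "\<L> = generate int_vec_group (a ` J)"
    and zeros: "\<And>i. zero_set (insert (indet i) (binom ` a ` J) :: ('k::field, 's) mpoly set) = {0}"
  shows "complete_intersection mpoly_ring (lattice_ideal \<L> :: ('k, 's) mpoly set)"
proof -
  let ?L = "lattice_ideal \<L> :: ('k, 's) mpoly set"
  let ?P = "\<lambda>j. supp (pos_part (a j))" and ?N = "\<lambda>j. supp (neg_part (a j))"
  have sub: "subgroup \<L> int_vec_group" unfolding gen by (rule subgroup_generate_int_vec)
  have aL: "a j \<in> \<L>" if "j \<in> J" for j unfolding gen using that by (intro generate.incl imageI)
  \<comment> \<open>With positive weights only the exponent 0 has weight 0, so by homogeneity either
    both monomials of a lattice binomial are 1 or neither is.\<close>
  have supp0: "supp x = {} \<longleftrightarrow> wdeg \<omega> x = 0" for x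
  proof -
    have "supp x = {} \<longleftrightarrow> x = 0" by (auto simp: supp_def vec_eq_iff)
    then show ?thesis using wdeg_pos[OF omega, of x] by (auto simp: wdeg_def)
  qed
  have glued: "glued ?P ?N UNIV J"
  proof (rule glued_UNIV)
    show "finite J" "card J = CARD('s) - 1" by (simp_all add: J_def)
    show "?P j = {} \<longleftrightarrow> ?N j = {}" if "j \<in> J" for j
      unfolding supp0 wdeg_pos_neg_part[OF homog aL[OF that]] ..
    show "\<exists>j\<in>J. (?P j \<subseteq> T) \<noteq> (?N j \<subseteq> T)" if T: "T \<noteq> {}" "T \<noteq> UNIV" for T
    proof -
      \<comment> \<open>The indicator point of \<open>T\<close> is nonzero and a zero of
        \<open>t_i\<close> for \<open>i\<close> outside \<open>T\<close>. By \<open>zeros\<close>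
        some binomial does not vanish there, which means that exactly one of its monomials is
        supported in \<open>T\<close>.\<close>
      define x :: "'k ^ 's" where "x = (\<chi> i. if i \<in> T then 1 else 0)"
      obtain i where i: "i \<notin> T" using T(2) by auto
      have "x \<noteq> 0" using T(1) by (auto simp: x_def vec_eq_iff)
      then have "x \<notin> zero_set (insert (indet i) (binom ` a ` J))" using zeros[of i] by auto
      moreover have "eval_mpoly (indet i) x = 0" using i by (simp add: eval_mpoly_indet x_def)
      ultimately obtain j where j: "j \<in> J" "eval_mpoly (binom (a j)) x \<noteq> 0"
        by (auto simp: zero_set_def)
      have "eval_mpoly (binom (a j)) x = (if ?P j \<subseteq> T then 1 else 0) - (if ?N j \<subseteq> T then 1 else 0)"
        unfolding binom_def eval_mpoly_diff x_def eval_monomial_indicator ..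
      with j show ?thesis by (intro bexI[of _ j]) (auto split: if_splits)
    qed
  qed
  have L: "?L = Idl\<^bsub>mpoly_ring\<^esub> (binom ` a ` J)"
  proof
    have "binom ` \<L> \<subseteq> Idl\<^bsub>mpoly_ring\<^esub> (binom ` a ` J :: ('k, 's) mpoly set)"
      using glued_binom_in_Idl[OF glued] unfolding gen by auto
    then show "?L \<subseteq> Idl\<^bsub>mpoly_ring\<^esub> (binom ` a ` J)"
      unfolding lattice_ideal_binom by (intro Idl_subsetI ideal_Idl)
    have "binom ` a ` J \<subseteq> (binom ` \<L> :: ('k, 's) mpoly set)" using aL by (intro image_mono) auto
    also have "\<dots> \<subseteq> ?L" unfolding lattice_ideal_binom by (rule Idl_superset)
    finally show "Idl\<^bsub>mpoly_ring\<^esub> (binom ` a ` J) \<subseteq> ?L"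
      unfolding lattice_ideal_binom by (intro Idl_subsetI ideal_Idl)
  qed
  obtain i :: 's where True by simp
  have "\<exists>m n. m > 0 \<and> indet k ^ m - indet i ^ n \<in> ?L" if "k \<noteq> i" for k
  proof -
    have "a ` J \<subseteq> \<L>" using aL by auto
    from glued_axis_difference[OF glued sub this UNIV_I UNIV_I]
    obtain m n where mn: "m > 0" "n > 0" "axis k m - axis i n \<in> \<L>" by metis
    have "binom (axis k m - axis i n) \<in> (binom ` \<L> :: ('k, 's) mpoly set)" using mn(3) by (rule imageI)
    then have "binom (axis k m - axis i n) \<in> ?L"
      unfolding lattice_ideal_binom using Idl_superset by (rule rev_subsetD)
    then have "indet k ^ nat m - indet i ^ nat n \<in> ?L"
      using binom_axis_difference[OF _ mn(1,2)] that by metis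
    moreover have "nat m > 0" using mn(1) by simp
    ultimately show ?thesis by (intro exI conjI)
  qed
  then have "enat (CARD('s) - 1) \<le> ideal_height mpoly_ring ?L" by (rule ideal_height_ge)
  then have "enat (CARD('s) - 1) = ideal_height mpoly_ring ?L"
    using ideal_height_lattice_ideal_le[OF omega homog, where 'k = 'k] by (rule antisym)
  moreover have "ideal ?L mpoly_ring" unfolding lattice_ideal_binom by (rule ideal_Idl)
  moreover have "(\<lambda>j. binom (a j)) ` {..<CARD('s) - 1} \<subseteq> carrier (mpoly_ring :: ('k, 's) mpoly ring)"
    by (simp add: ring_of_type_algebra_def)
  moreover have "?L = Idl\<^bsub>mpoly_ring\<^esub> ((\<lambda>j. binom (a j)) ` {..<CARD('s) - 1})"
    using L unfolding J_def image_image .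
  ultimately show ?thesis unfolding complete_intersection_def by (intro conjI exI)
qed

text \<open>The height bound leaves at most s - 1 generators, which are exchanged for no more
  lattice binomials; these determine the lattice by \<open>lattice_generated\<close>.\<close>

lemma binomials_of_complete_intersection:
  fixes \<omega> :: "int ^ 's::finite" and \<L> :: "(int ^ 's) set"
  assumes omega: "\<And>i. \<omega> $ i > 0" and homog: "homogeneous_lattice \<omega> \<L>"
    and sub: "subgroup \<L> int_vec_group"
    and ci: "complete_intersection mpoly_ring (lattice_ideal \<L> :: ('k::field, 's) mpoly set)"
  shows "\<exists>a. a ` {..<CARD('s) - 1} \<subseteq> \<L> \<and> \<L> = generate int_vec_group (a ` {..<CARD('s) - 1}) \<and>
    (lattice_ideal \<L> :: ('k, 's) mpoly set) = Idl\<^bsub>mpoly_ring\<^esub> (binom ` a ` {..<CARD('s) - 1})"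
proof -
  let ?L = "lattice_ideal \<L> :: ('k, 's) mpoly set" and ?J = "{..<CARD('s) - 1}"
  from ci obtain r and g :: "nat \<Rightarrow> ('k, 's) mpoly" where
    g: "?L = Idl\<^bsub>mpoly_ring\<^esub> (g ` {..<r})" and r: "enat r = ideal_height mpoly_ring ?L"
    unfolding complete_intersection_def by (elim conjE exE)
  have "enat r \<le> enat (CARD('s) - 1)" unfolding r by (rule ideal_height_lattice_ideal_le[OF omega homog])
  then have r: "r \<le> CARD('s) - 1" by simp
  have "finite (g ` {..<r})" by simp
  from binomial_generators[OF omega homog this g]
  obtain B where B: "B \<subseteq> \<L>" "finite B" "card B \<le> card (g ` {..<r})" "?L = Idl\<^bsub>mpoly_ring\<^esub> (binom ` B)"
    by (elim exE conjE)
  have card: "card B \<le> CARD('s) - 1" using B(3) card_image_le[of "{..<r}" g] r by simp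
  obtain n and f :: "nat \<Rightarrow> int ^ 's" where f: "B = f ` {i. i < n}" "inj_on f {i. i < n}"
    using finite_imp_nat_seg_image_inj_on[OF B(2)] by metis
  have n: "n \<le> CARD('s) - 1" using card card_image[OF f(2)] f(1) by simp
  \<comment> \<open>If there are fewer than s - 1 binomials, the list is padded with the zero
    vector, which lies in the lattice and has binomial 0.\<close>
  define a where "a i = (if i < n then f i else 0)" for i
  have BJ: "B \<subseteq> a ` ?J" using n by (auto simp: f(1) a_def intro!: image_eqI)
  have "0 \<in> \<L>" using sub unfolding subgroup_int_vec_iff by (elim conjE)
  then have JL: "a ` ?J \<subseteq> \<L>" using B(1) by (auto simp: f(1) a_def)
  have "binom ` \<L> \<subseteq> ?L" unfolding lattice_ideal_binom by (rule Idl_superset)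
  then have "\<L> \<subseteq> generate int_vec_group B" unfolding B(4) by (rule lattice_generated)
  also have "\<dots> \<subseteq> generate int_vec_group (a ` ?J)"
    using BJ by (intro generate_int_vec_subset subgroup_generate_int_vec) (auto intro: generate.incl)
  finally have "\<L> = generate int_vec_group (a ` ?J)"
    using generate_int_vec_subset[OF sub JL] by (rule antisym)
  moreover have "?L = Idl\<^bsub>mpoly_ring\<^esub> (binom ` a ` ?J)"
  proof
    have "binom ` B \<subseteq> (binom ` a ` ?J :: ('k, 's) mpoly set)" using BJ by (rule image_mono)
    also have "\<dots> \<subseteq> Idl\<^bsub>mpoly_ring\<^esub> (binom ` a ` ?J)" by (rule Idl_superset)
    finally show "?L \<subseteq> Idl\<^bsub>mpoly_ring\<^esub> (binom ` a ` ?J)" unfolding B(4) by (intro Idl_subsetI ideal_Idl)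
    have "binom ` a ` ?J \<subseteq> (binom ` \<L> :: ('k, 's) mpoly set)" using JL by (rule image_mono)
    also have "\<dots> \<subseteq> ?L" unfolding lattice_ideal_binom by (rule Idl_superset)
    finally show "Idl\<^bsub>mpoly_ring\<^esub> (binom ` a ` ?J) \<subseteq> ?L"
      unfolding lattice_ideal_binom by (intro Idl_subsetI ideal_Idl)
  qed
  ultimately show ?thesis using JL by (intro exI conjI)
qed

theorem theorem2p14:
  fixes \<omega> :: "int ^ 's::finite"
    and \<L> :: "(int ^ 's) set"
    and L :: "('k::field, 's) mpoly set"
  assumes omega_pos: "\<And>i. \<omega> $ i > 0"
    and lattice: "subgroup \<L> int_vec_group"
    and homog: "homogeneous_lattice \<omega> \<L>"
    and L_def: "L = lattice_ideal \<L>"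
    and zeros: "\<And>i. zero_set (Idl\<^bsub>mpoly_ring\<^esub> (insert (indet i) L)) = {0}"
  shows "complete_intersection mpoly_ring L \<longleftrightarrow>
    (\<exists>h :: nat \<Rightarrow> ('k, 's) mpoly.
       (\<forall>j < CARD('s) - 1. h j \<in> L \<and> is_binomial (h j) \<and> homogeneous \<omega> (h j)) \<and>
       \<L> = generate int_vec_group ((\<lambda>j. binomial_hat (h j)) ` {..<CARD('s) - 1}) \<and>
       (\<forall>i. zero_set (insert (indet i) (h ` {..<CARD('s) - 1})) = {0}) \<and>
       (\<forall>j < CARD('s) - 1. \<exists>a :: int ^ 's. h j = monomial (pos_part a) - monomial (neg_part a)))"
    (is "_ \<longleftrightarrow> (\<exists>h. ?C h)")
proof
  let ?J = "{..<CARD('s) - 1}"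
  assume ci: "complete_intersection mpoly_ring L"
  from binomials_of_complete_intersection[OF omega_pos homog lattice ci[unfolded L_def]]
  obtain a where aL: "a ` ?J \<subseteq> \<L>" and gen: "\<L> = generate int_vec_group (a ` ?J)"
    and L: "L = Idl\<^bsub>mpoly_ring\<^esub> (binom ` a ` ?J)"
    unfolding L_def by (elim exE conjE)
  define h :: "nat \<Rightarrow> ('k, 's) mpoly" where "h j = binom (a j)" for j
  have hJ: "h ` ?J = binom ` a ` ?J" by (simp add: h_def image_image)
  have "?C h"
  proof (intro conjI allI impI)
    fix j assume j: "j < CARD('s) - 1"
    have "h j \<in> h ` ?J" using j by simp
    then show "h j \<in> L" unfolding hJ L using Idl_superset by (rule rev_subsetD)
    show "is_binomial (h j)" unfolding is_binomial_def h_def binom_def by (rule exI, rule exI, rule HOL.refl)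
    show "homogeneous \<omega> (h j)"
      unfolding h_def by (rule homogeneous_binom[OF homog]) (use aL j in auto)
    show "\<exists>a. h j = monomial (pos_part a) - monomial (neg_part a)"
      unfolding h_def binom_def by (rule exI, rule HOL.refl)
  next
    have "generate int_vec_group ((\<lambda>j. binomial_hat (h j)) ` ?J) = generate int_vec_group (a ` ?J)"
      unfolding h_def by (rule generate_sign) (rule binomial_hat_binom)
    then show "\<L> = generate int_vec_group ((\<lambda>j. binomial_hat (h j)) ` ?J)" using gen by simp
  next
    fix i
    have insert: "zero_set (insert f F) = zero_set {f} \<inter> zero_set F" for f and F :: "('k, 's) mpoly set"
      by (auto simp: zero_set_def)
    \<comment> \<open>As the \<open>h j\<close> generate \<open>L\<close>, they have the same zeros,
      and the assumption on the zeros of \<open>L\<close> carries over to them.\<close>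
    have "zero_set (h ` ?J) = zero_set L" unfolding hJ L zero_set_Idl ..
    then have "zero_set (insert (indet i) (h ` ?J)) = zero_set (insert (indet i) L)"
      by (subst (1 2) insert) simp
    then show "zero_set (insert (indet i) (h ` ?J)) = {0}" using zeros[of i] unfolding zero_set_Idl by simp
  qed
  then show "\<exists>h. ?C h" by (rule exI[of _ h])
next
  let ?J = "{..<CARD('s) - 1}"
  assume "\<exists>h. ?C h"
  then obtain h where "?C h" by (rule exE)
  then have gen: "\<L> = generate int_vec_group ((\<lambda>j. binomial_hat (h j)) ` ?J)"
    and zero: "\<forall>i. zero_set (insert (indet i) (h ` ?J)) = {0}"
    and ex: "\<forall>j < CARD('s) - 1. \<exists>a. h j = monomial (pos_part a) - monomial (neg_part a)"
    by iprover+
  \<comment> \<open>Condition (iii) supplies the vectors \<open>a j\<close>. They agree with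
    \<open>binomial_hat (h j)\<close> up to sign, so by (i) they generate the lattice.\<close>
  from ex have "\<forall>j. \<exists>a. j < CARD('s) - 1 \<longrightarrow> h j = binom a" unfolding binom_def by metis
  then obtain a where a: "\<And>j. j < CARD('s) - 1 \<Longrightarrow> h j = binom (a j)" by metis
  have hJ: "h ` ?J = binom ` a ` ?J" unfolding image_image by (rule image_cong) (simp_all add: a)
  have "generate int_vec_group ((\<lambda>j. binomial_hat (h j)) ` ?J) = generate int_vec_group (a ` ?J)"
  proof (rule generate_sign)
    fix j assume "j \<in> ?J"
    then have "h j = binom (a j)" by (simp add: a)
    then show "binomial_hat (h j) = a j \<or> binomial_hat (h j) = - a j"
      using binomial_hat_binom[of "a j", where 'k = 'k] by simp
  qed
  then have "\<L> = generate int_vec_group (a ` ?J)" using gen by simp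
  moreover have "zero_set (insert (indet i) (binom ` a ` ?J) :: ('k, 's) mpoly set) = {0}" for i
    using zero hJ by simp
  ultimately show "complete_intersection mpoly_ring L"
    unfolding L_def by (rule complete_intersection_of_binomials[OF omega_pos homog])
qed

end
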